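(* Let $(X_1,\dots,X_n)$ be the output of $\textsc{DepRound}$ run with probabilities $p_1=\dots=p_n=p\in(0,1)$ and positive weights $(a_1,\dots,a_n)$, and let $\alpha:=\min\{p,1-p\}$. Let $I^+,I^-$ be disjoint subsets of $[n]$, $t:=|I^+\cup I^-|$, and $\lambda:=p^{|I^+|}(1-p)^{|I^-|}$. If $a_{\max}/a_{\min}\le 1+\alpha$, where $a_{\min}=\min_i a_i$ and $a_{\max}=\max_i a_i$, then $$\left(1-\frac{8t(t-1)}{3n\alpha^2}\right)\lambda\le\mathbf{E}\left[\prod_{i\in I^+}X_i\prod_{i\in I^-}(1-X_i)\right]\le\left(1+\frac{8t}{3n\alpha^2}\right)^{t-1}\lambda.$$
   Context: For $a_1,a_2>0$, $\beta_1,\beta_2\in(0,1)$, $\textsc{Simplify}(a_1,a_2,\beta_1,\beta_2)$ outputs $(\gamma_1,\gamma_2)$: let $s=a_1\beta_1+a_2\beta_2$ and apply the first case whose condition holds. Case I ($s\le\min\{a_1,a_2\}$): w.p. $a_2\beta_2/s$ set $\gamma_1=0$, otherwise $\gamma_2=0$. Case II ($a_1<s<a_2$): w.p. $\beta_1$ set $\gamma_1=1$, otherwise $\gamma_1=0$. Case III ($a_2<s<a_1$): w.p. $\beta_2$ set $\gamma_2=1$, otherwise $\gamma_2=0$. Case IV ($\max\{a_1,a_2\}\le s\le a_1+a_2$): w.p. $a_2(1-\beta_2)/(a_1(1-\beta_1)+a_2(1-\beta_2))$ set $\gamma_1=1$, otherwise $\gamma_2=1$. Then: if $\gamma_1=0$,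 $\gamma_2=\beta_2+\beta_1a_1/a_2$; if $\gamma_1=1$, $\gamma_2=\beta_2-(1-\beta_1)a_1/a_2$; if $\gamma_2=0$, $\gamma_1=\beta_1+\beta_2a_2/a_1$; if $\gamma_2=1$, $\gamma_1=\beta_1-(1-\beta_2)a_2/a_1$. $\textsc{DepRound}$ with $P=(p_1,\dots,p_n)$ and weights $A=(a_1,\dots,a_n)$: set $X=P$; choose a uniformly random permutation $\pi$ of $[n]$; while $X$ has at least two entries in $(0,1)$, let $X_i,X_j$ be the two fractional entries earliest in the $\pi$-order ($X_i$ first) and replace $(X_i,X_j)$ by $\textsc{Simplify}(a_i,a_j,X_i,X_j)$; output $X$. *)

theory Defs
  imports "HOL-Probability.Probability" "HOL-Combinatorics.Permutations"
begin

text \<open>The last branch is Case IV: for \<open>a\<^sub>1, a\<^sub>2 > 0\<close> and \<open>\<beta>\<^sub>1, \<beta>\<^sub>2 \<in> (0,1)\<close> the bound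
  \<open>s \<le> a\<^sub>1 + a\<^sub>2\<close> always holds, and failure of the first three conditions
  gives \<open>max {a\<^sub>1, a\<^sub>2} \<le> s\<close>. For such arguments every parameter given to
  \<open>bernoulli_pmf\<close> lies in \<open>[0,1]\<close>, so it is never clamped.\<close>

definition simplify :: "real \<Rightarrow> real \<Rightarrow> real \<Rightarrow> real \<Rightarrow> (real \<times> real) pmf" where
  "simplify a1 a2 \<beta>1 \<beta>2 =
    (let s = a1 * \<beta>1 + a2 * \<beta>2;
         first0 = (0, \<beta>2 + \<beta>1 * a1 / a2);
         first1 = (1, \<beta>2 - (1 - \<beta>1) * a1 / a2);
         second0 = (\<beta>1 + \<beta>2 * a2 / a1, 0);
         second1 = (\<beta>1 - (1 - \<beta>2) * a2 / a1, 1)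
     in if s \<le> min a1 a2 then
          map_pmf (\<lambda>c. if c then first0 else second0) (bernoulli_pmf (a2 * \<beta>2 / s))
        else if a1 < s \<and> s < a2 then
          map_pmf (\<lambda>c. if c then first1 else first0) (bernoulli_pmf \<beta>1)
        else if a2 < s \<and> s < a1 then
          map_pmf (\<lambda>c. if c then second1 else second0) (bernoulli_pmf \<beta>2)
        else
          map_pmf (\<lambda>c. if c then first1 else second1)
            (bernoulli_pmf (a2 * (1 - \<beta>2) / (a1 * (1 - \<beta>1) + a2 * (1 - \<beta>2)))))"

definition fractional :: "nat \<Rightarrow> (nat \<Rightarrow> real) \<Rightarrow> nat set" where
  "fractional n X = {k \<in> {1..n}. 0 < X k \<and> X k < 1}"

lemma finite_fractional [simp]: "finite (fractional n X)"
  by (simp add: fractional_def)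

lemma simplify_integral:
  "(u, v) \<in> set_pmf (simplify a1 a2 \<beta>1 \<beta>2) \<Longrightarrow> u \<in> {0, 1} \<or> v \<in> {0, 1}"
  by (auto simp: simplify_def Let_def split: if_splits)

lemma card_fractional_update_less:
  assumes "i \<in> fractional n X" "j \<in> fractional n X" "u \<in> {0, 1} \<or> v \<in> {0, 1}" "i \<noteq> j"
  shows "card (fractional n (X(i := u, j := v))) < card (fractional n X)"
proof (rule psubset_card_mono)
  show "fractional n (X(i := u, j := v)) \<subset> fractional n X"
    using assms by (auto simp: fractional_def)
qed simp

text \<open>Here \<open>\<pi> k\<close> is the position of index \<open>k\<close>, so that \<open>i\<close> precedes \<open>j\<close> in the
  \<open>\<pi>\<close>-order iff \<open>\<pi> i < \<pi> j\<close>. Each vector is a function on \<open>nat\<close> of which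
  only the entries in \<open>{1..n}\<close> matter.\<close>

definition first_two_fractional ::
    "nat \<Rightarrow> (nat \<Rightarrow> nat) \<Rightarrow> (nat \<Rightarrow> real) \<Rightarrow> nat \<times> nat" where
  "first_two_fractional n \<pi> X =
    (let i = arg_min \<pi> (\<lambda>k. k \<in> fractional n X);
         j = arg_min \<pi> (\<lambda>k. k \<in> fractional n X - {i})
     in (i, j))"

lemma first_two_fractional:
  assumes "2 \<le> card (fractional n X)" "first_two_fractional n \<pi> X = (i, j)"
  shows "i \<in> fractional n X" "j \<in> fractional n X" "i \<noteq> j"
proof -
  let ?F = "fractional n X"
  have i: "i = arg_min \<pi> (\<lambda>k. k \<in> ?F)" and j: "j = arg_min \<pi> (\<lambda>k. k \<in> ?F - {i})"
    using assms(2) by (auto simp: first_two_fractional_def Let_def)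
  from assms(1) obtain x where "x \<in> ?F" by fastforce
  then show iF: "i \<in> ?F" unfolding i by (rule arg_min_natI)
  have "card (?F - {i}) \<noteq> 0" using assms(1) iF by simp
  then obtain y where "y \<in> ?F - {i}" by (metis card.empty ex_in_conv)
  then have "j \<in> ?F - {i}" unfolding j by (rule arg_min_natI)
  then show "j \<in> ?F" "i \<noteq> j" by auto
qed

function depround_loop ::
    "nat \<Rightarrow> (nat \<Rightarrow> real) \<Rightarrow> (nat \<Rightarrow> nat) \<Rightarrow> (nat \<Rightarrow> real) \<Rightarrow> (nat \<Rightarrow> real) pmf" where
  "depround_loop n a \<pi> X =
    (if 2 \<le> card (fractional n X) then
       (case first_two_fractional n \<pi> X of (i, j) \<Rightarrow>
          bind_pmf (simplify (a i) (a j) (X i) (X j))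
            (\<lambda>(u, v). depround_loop n a \<pi> (X(i := u, j := v))))
     else return_pmf X)"
  by pat_completeness auto
termination
proof (relation "Wellfounded.measure (\<lambda>(n, a, \<pi>, X). card (fractional n X))", goal_cases)
  case 1
  then show ?case by simp
next
  case (2 n a \<pi> X i j z u v)
  have "card (fractional n (X(i := u, j := v))) < card (fractional n X)"
    using 2(2)[symmetric] 2(1,3,4) first_two_fractional[of n X \<pi> i j] simplify_integral[of u v]
    by (intro card_fractional_update_less) auto
  then show ?case by simp
qed

declare depround_loop.simps [simp del]

definition depround :: "nat \<Rightarrow> (nat \<Rightarrow> real) \<Rightarrow> (nat \<Rightarrow> real) \<Rightarrow> (nat \<Rightarrow> real) pmf" where
  "depround n P a =
    bind_pmf (pmf_of_set {\<pi>. \<pi> permutes {1..n}}) (\<lambda>\<pi>. depround_loop n a \<pi> P)"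

end

theory Submission imports Defs begin

text \<open>Fix the permutation. At every moment at most one processed entry is fractional, and
  \<open>Simplify\<close> preserves the expectation of each of its two entries, so the expected product can only
  deviate from \<open>\<lambda>\<close> when an entry of \<open>I\<^sup>+ \<union> I\<^sup>-\<close> is still fractional at the moment the next
  index of \<open>I\<^sup>+ \<union> I\<^sup>-\<close> is met. Surviving two consecutive steps has probability at most
  \<open>1 - \<alpha>\<close>, so a gap of length \<open>g\<close> between consecutive indices of \<open>I\<^sup>+ \<union> I\<^sup>-\<close> costs a relative
  error of at most \<open>c\<^sub>g = (1 - \<alpha>) ^ ((g - 1) div 2) / \<alpha>\<close>. Hence, given the permutation, the
  expectation lies between \<open>\<lambda> * (1 - \<Sum>c\<^sub>g)\<close> and \<open>\<lambda> * (\<Prod>(1 + c\<^sub>g))\<close>, both over the \<open>t - 1\<close> gaps.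
  The positions of \<open>I\<^sup>+ \<union> I\<^sup>-\<close> form a uniformly random \<open>t\<close>-subset; any \<open>r\<close> given gaps have
  prescribed lengths with probability at most \<open>(t / n) ^ r\<close>, and the \<open>c\<^sub>g\<close> sum to at most
  \<open>2 / \<alpha>\<^sup>2\<close>.\<close>

section \<open>Gaps in binary words\<close>

text \<open>The list marks which of the upcoming indices belong to \<open>I\<^sup>+ \<union> I\<^sup>-\<close>. The value bounds
  the probability that the current fractional entry is still fractional when the first marked
  index is reached.
  Every second step costs a factor \<open>1 - \<alpha>\<close>, and \<open>m\<close> counts the steps already made.\<close>

fun carry :: "real \<Rightarrow> nat \<Rightarrow> bool list \<Rightarrow> real" where
  "carry \<alpha> m [] = 0"
| "carry \<alpha> m (b # bs) = (if b then (1 - \<alpha>) ^ (m div 2) else carry \<alpha> (Suc m) bs)"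

text \<open>Division by \<alpha> turns the absolute loss \<open>carry\<close> into a relative one,
  since \<open>p\<close> and \<open>1 - p\<close> are at least \<alpha>. The last mark contributes
  1, as no mark is left to be reached.\<close>

fun gap_prod :: "real \<Rightarrow> bool list \<Rightarrow> real" where
  "gap_prod \<alpha> [] = 1"
| "gap_prod \<alpha> (b # bs) = (if b then 1 + carry \<alpha> 0 bs / \<alpha> else 1) * gap_prod \<alpha> bs"

fun gap_sum :: "real \<Rightarrow> bool list \<Rightarrow> real" where
  "gap_sum \<alpha> [] = 0"
| "gap_sum \<alpha> (b # bs) = (if b then carry \<alpha> 0 bs / \<alpha> else 0) + gap_sum \<alpha> bs"

definition bool_lists :: "nat \<Rightarrow> nat \<Rightarrow> bool list set" where
  "bool_lists n t = {bs. length bs = n \<and> count_list bs True = t}"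

text \<open>For \<open>j \<le> t \<le> n\<close> this is \<open>\<Sum>r\<le>j. (j choose r) * \<sigma> ^ r * ((n - r) choose (t - r))\<close>: choosing
  \<open>r\<close> of the \<open>j\<close> gaps between consecutive marks and contracting them.\<close>

fun gap_weight :: "real \<Rightarrow> nat \<Rightarrow> nat \<Rightarrow> nat \<Rightarrow> real" where
  "gap_weight \<sigma> 0 n t = real (n choose t)"
| "gap_weight \<sigma> (Suc j) n t =
     gap_weight \<sigma> j n t + (if n = 0 \<or> t = 0 then 0 else \<sigma> * gap_weight \<sigma> j (n - 1) (t - 1))"

lemma carry_nonneg: "\<alpha> \<le> 1 \<Longrightarrow> 0 \<le> carry \<alpha> m bs"
  by (induction \<alpha> m bs rule: carry.induct) auto

lemma carry_Suc_le: "0 \<le> \<alpha> \<Longrightarrow> \<alpha> \<le> 1 \<Longrightarrow> carry \<alpha> (Suc m) bs \<le> carry \<alpha> m bs"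
  by (induction \<alpha> m bs rule: carry.induct) (auto intro!: power_decreasing div_le_mono)

lemma carry_add_2: "carry \<alpha> (Suc (Suc m)) bs = (1 - \<alpha>) * carry \<alpha> m bs"
  by (induction \<alpha> m bs rule: carry.induct) auto

lemma gap_prod_ge_1: "0 < \<alpha> \<Longrightarrow> \<alpha> \<le> 1 \<Longrightarrow> 1 \<le> gap_prod \<alpha> bs"
proof (induction bs)
  case (Cons b bs)
  then show ?case
    using mult_mono[of 1 "1 + carry \<alpha> 0 bs / \<alpha>" 1 "gap_prod \<alpha> bs"] carry_nonneg[of \<alpha> 0 bs] by auto
qed simp

lemma gap_sum_nonneg: "0 < \<alpha> \<Longrightarrow> \<alpha> \<le> 1 \<Longrightarrow> 0 \<le> gap_sum \<alpha> bs"
  by (induction bs) (auto simp: carry_nonneg)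

section \<open>Words of given length with a given number of marks\<close>

lemma finite_bool_lists [simp]: "finite (bool_lists n t)"
  by (rule finite_subset[OF _ finite_lists_length_eq[of UNIV n]]) (auto simp: bool_lists_def)

lemma bool_lists_0_left: "bool_lists 0 t = (if t = 0 then {[]} else {})"
  by (auto simp: bool_lists_def)

lemma bool_lists_0_right: "bool_lists n 0 = {replicate n False}"
proof (induction n)
  case (Suc n)
  have "bool_lists (Suc n) 0 = (#) False ` bool_lists n 0"
    by (auto simp: bool_lists_def length_Suc_conv split: if_splits)
  then show ?case by (simp add: Suc)
qed (simp add: bool_lists_0_left)

lemma bool_lists_Suc:
  "bool_lists (Suc n) (Suc t) = (#) False ` bool_lists n (Suc t) \<union> (#) True ` bool_lists n t"
  by (auto simp: bool_lists_def length_Suc_conv image_iff split: if_splits)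

lemma sum_bool_lists_Suc:
  fixes f :: "bool list \<Rightarrow> real"
  shows "(\<Sum>bs\<in>bool_lists (Suc n) (Suc t). f bs)
    = (\<Sum>bs\<in>bool_lists n (Suc t). f (False # bs)) + (\<Sum>bs\<in>bool_lists n t. f (True # bs))"
  unfolding bool_lists_Suc
  by (subst sum.union_disjoint) (auto simp: sum.reindex)

lemma card_bool_lists: "card (bool_lists n t) = n choose t"
proof (induction n arbitrary: t)
  case (Suc n)
  show ?case
    using Suc sum_bool_lists_Suc[of "\<lambda>_. 1" n "t - 1"]
    by (cases t) (simp_all add: bool_lists_0_right)
qed (simp add: bool_lists_0_left)

lemma carry_replicate_False [simp]: "carry \<alpha> m (replicate n False) = 0"
  by (induction n arbitrary: m) auto

lemma gap_prod_replicate_False [simp]: "gap_prod \<alpha> (replicate n False) = 1"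
  by (induction n) auto

lemma gap_sum_replicate_False [simp]: "gap_sum \<alpha> (replicate n False) = 0"
  by (induction n) auto

text \<open>Split by the number \<open>g\<close> of unmarked letters before the first mark. Such
  words have \<open>carry\<close> equal to \<open>(1 - \<alpha>) ^ ((m + g) div 2)\<close>, and as
  \<open>f\<close> ignores leading unmarked letters, the remaining sum is at most
  \<open>M\<close>.\<close>

lemma sum_carry_le:
  assumes "\<alpha> \<le> 1" "0 \<le> M"
    and f: "\<And>bs. f (False # bs) = f bs"
    and M: "\<And>k. k < n \<Longrightarrow> (\<Sum>bs\<in>bool_lists k t. f (True # bs)) \<le> M"
  shows "(\<Sum>bs\<in>bool_lists n (Suc t). carry \<alpha> m bs * f bs) \<le> (\<Sum>g<n. (1 - \<alpha>) ^ ((m + g) div 2)) * M"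
  using M
proof (induction n arbitrary: m)
  case 0
  then show ?case by (simp add: bool_lists_0_left)
next
  case (Suc n)
  have "(\<Sum>bs\<in>bool_lists (Suc n) (Suc t). carry \<alpha> m bs * f bs)
      = (\<Sum>bs\<in>bool_lists n (Suc t). carry \<alpha> (Suc m) bs * f bs)
        + (1 - \<alpha>) ^ (m div 2) * (\<Sum>bs\<in>bool_lists n t. f (True # bs))"
    by (simp add: sum_bool_lists_Suc f sum_distrib_left)
  also have "\<dots> \<le> (\<Sum>g<n. (1 - \<alpha>) ^ ((Suc m + g) div 2)) * M + (1 - \<alpha>) ^ (m div 2) * M"
    using Suc.IH[of "Suc m"] Suc.prems assms(1) by (intro add_mono mult_left_mono) auto
  also have "\<dots> = (\<Sum>g<Suc n. (1 - \<alpha>) ^ ((m + g) div 2)) * M"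
    by (simp add: sum.lessThan_Suc_shift algebra_simps del: sum.lessThan_Suc)
  finally show ?case .
qed

text \<open>Every exponent occurs twice, which leaves twice a geometric series with ratio
  \<open>1 - \<alpha>\<close>.\<close>

lemma sum_power_half_le:
  assumes "0 < \<alpha>" "\<alpha> \<le> (1::real)"
  shows "(\<Sum>g<n. (1 - \<alpha>) ^ (g div 2)) \<le> 2 / \<alpha>"
proof -
  have *: "(\<Sum>g<2 * m. (1 - \<alpha>) ^ (g div 2)) = 2 * (\<Sum>g<m. (1 - \<alpha>) ^ g)" for m
    by (induction m) auto
  have "(\<Sum>g<n. (1 - \<alpha>) ^ (g div 2)) \<le> (\<Sum>g<2 * n. (1 - \<alpha>) ^ (g div 2))"
    using assms by (intro sum_mono2) auto
  also have "\<dots> = 2 * ((1 - (1 - \<alpha>) ^ n) / \<alpha>)"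
    unfolding * using assms by (simp add: sum_gp_strict)
  also have "\<dots> \<le> 2 / \<alpha>"
    using assms by (simp add: divide_right_mono)
  finally show ?thesis .
qed

section \<open>Estimates for gap weights\<close>

lemma gap_weight_nonneg: "0 \<le> \<sigma> \<Longrightarrow> 0 \<le> gap_weight \<sigma> j n t"
  by (induction \<sigma> j n t rule: gap_weight.induct) auto

lemma gap_weight_mono:
  assumes "0 \<le> \<sigma>" "m \<le> n"
  shows "gap_weight \<sigma> j m t \<le> gap_weight \<sigma> j n t"
  using assms(2)
proof (induction j arbitrary: m n t)
  case 0
  then show ?case by (simp add: binomial_right_mono)
next
  case (Suc j)
  have "\<sigma> * gap_weight \<sigma> j (m - 1) (t - 1) \<le> \<sigma> * gap_weight \<sigma> j (n - 1) (t - 1)"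
    using Suc.prems by (intro mult_left_mono Suc.IH assms(1)) auto
  moreover have "0 \<le> \<sigma> * gap_weight \<sigma> j (n - 1) (t - 1)"
    using assms(1) by (simp add: gap_weight_nonneg)
  ultimately show ?case
    using Suc.IH[OF Suc.prems, of t] Suc.prems by auto
qed

text \<open>Level 0 is Pascal's rule. Each further level adds \<sigma> times the same inequality at
  \<open>(n - 1, t - 1)\<close>; at the boundary \<open>n = 0\<close> or \<open>t = 0\<close>,
  monotonicity and nonnegativity take its place.\<close>

lemma gap_weight_pascal:
  assumes "0 \<le> \<sigma>"
  shows "gap_weight \<sigma> j n (Suc t) + gap_weight \<sigma> j n t \<le> gap_weight \<sigma> j (Suc n) (Suc t)"
proof (induction j arbitrary: n t)
  case (Suc j)
  let ?w = "gap_weight \<sigma> j"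
  have "(if n = 0 then 0 else ?w (n - 1) t) + (if n = 0 \<or> t = 0 then 0 else ?w (n - 1) (t - 1)) \<le> ?w n t"
  proof (cases "n = 0 \<or> t = 0")
    case True
    then show ?thesis
      using assms gap_weight_mono[OF assms, of "n - 1" n j t] gap_weight_nonneg[OF assms] by auto
  next
    case False
    then show ?thesis using Suc[of "n - 1" "t - 1"] by simp
  qed
  from mult_left_mono[OF this assms] Suc[of n t] show ?case
    by (auto simp: algebra_simps split: if_splits)
qed simp

text \<open>Lowering both arguments by one multiplies the binomial coefficient by
  \<open>t / n\<close>, and \<open>(t - 1) / (n - 1)\<close> is at most \<open>t / n\<close>. So
  each level costs at most a factor \<open>1 + \<sigma> * t / n\<close>.\<close>

lemma gap_weight_le:
  assumes "0 \<le> \<sigma>" "t \<le> n"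
  shows "gap_weight \<sigma> j n t \<le> real (n choose t) * (1 + \<sigma> * real t / real n) ^ j"
  using assms(2)
proof (induction j arbitrary: n t)
  case (Suc j)
  let ?q = "1 + \<sigma> * real t / real n"
  show ?case
  proof (cases "n = 0 \<or> t = 0")
    case True
    then show ?thesis using Suc.IH[OF Suc.prems] by auto
  next
    case False
    then have nt: "n > 0" "t > 0" by auto
    \<comment> \<open>For \<open>n = 1\<close> the left side is a division by zero and thus
      0.\<close>
    have frac: "real (t - 1) / real (n - 1) \<le> real t / real n"
      using nt Suc.prems by (cases "n = 1") (auto simp: field_simps of_nat_diff)
    have binom: "real (n - 1 choose (t - 1)) = real (n choose t) * (real t / real n)"
      using nt times_binomial_minus1_eq[of t n]
      by (simp add: field_simps flip: of_nat_mult)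
    have "gap_weight \<sigma> j (n - 1) (t - 1)
        \<le> real (n - 1 choose (t - 1)) * (1 + \<sigma> * real (t - 1) / real (n - 1)) ^ j"
      using Suc nt by (intro Suc.IH) auto
    also have "\<dots> \<le> real (n - 1 choose (t - 1)) * ?q ^ j"
      using mult_left_mono[OF frac assms(1)] assms(1) by (intro mult_left_mono power_mono) auto
    finally have "\<sigma> * gap_weight \<sigma> j (n - 1) (t - 1)
        \<le> \<sigma> * (real (n choose t) * (real t / real n) * ?q ^ j)"
      using assms(1) unfolding binom by (intro mult_left_mono) auto
    then have "gap_weight \<sigma> (Suc j) n t
        \<le> real (n choose t) * ?q ^ j + \<sigma> * (real (n choose t) * (real t / real n) * ?q ^ j)"
      using Suc.IH[OF Suc.prems] nt by simp
    also have "\<dots> = real (n choose t) * ?q ^ Suc j"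
      by (simp add: algebra_simps)
    finally show ?thesis .
  qed
qed simp

text \<open>The value of \<sigma> bounds the sum of the relative losses over all gap lengths:
  \<open>2 / \<alpha>\<close> from the geometric series, and one more \<open>1 / \<alpha>\<close>
  from passing to relative losses.\<close>

lemma sum_carry_le_gap_weight:
  assumes \<alpha>: "0 < \<alpha>" "\<alpha> \<le> 1" and "\<sigma> = 2 / \<alpha>\<^sup>2" "0 \<le> M"
    and f: "\<And>bs. f (False # bs) = f bs"
    and M: "\<And>k. k < n \<Longrightarrow> (\<Sum>bs\<in>bool_lists k t. f (True # bs)) \<le> M"
  shows "(\<Sum>bs\<in>bool_lists n (Suc t). carry \<alpha> 0 bs / \<alpha> * f bs) \<le> \<sigma> * M"
proof -
  have "(\<Sum>bs\<in>bool_lists n (Suc t). carry \<alpha> 0 bs * f bs) / \<alpha>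
      \<le> (\<Sum>g<n. (1 - \<alpha>) ^ (g div 2)) * M / \<alpha>"
    using sum_carry_le[where m = 0, OF \<alpha>(2) assms(4) f M] \<alpha> by (intro divide_right_mono) auto
  also have "\<dots> \<le> 2 / \<alpha> * M / \<alpha>"
    using sum_power_half_le[OF \<alpha>] assms(4) \<alpha> by (intro divide_right_mono mult_right_mono) auto
  finally show ?thesis
    using assms(3) by (simp add: sum_divide_distrib power2_eq_square)
qed

text \<open>Both kinds of words have \<open>t\<close> gaps, hence level \<open>t\<close>. A leading
  mark gives a factor \<open>1 + c\<close>; for the summand 1 the first bound at the previous
  \<open>t\<close> applies, for \<open>c\<close> the second one on shorter words, and together they
  reproduce the recursion of \<open>gap_weight\<close>.\<close>

lemma sum_gap_prod_le:
  assumes \<alpha>: "0 < \<alpha>" "\<alpha> \<le> 1" and \<sigma>: "\<sigma> = 2 / \<alpha>\<^sup>2"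
  shows "(\<Sum>bs\<in>bool_lists n (Suc t). gap_prod \<alpha> bs) \<le> gap_weight \<sigma> t n (Suc t)"
    and "(\<Sum>bs\<in>bool_lists n t. gap_prod \<alpha> (True # bs)) \<le> gap_weight \<sigma> t n t"
proof (induction t arbitrary: n)
  have \<sigma>0: "0 \<le> \<sigma>" using \<sigma> by simp
  \<comment> \<open>The second bound implies the first at the same \<open>t\<close>: split by the
    first letter and recombine by Pascal's inequality.\<close>
  have total: "(\<Sum>bs\<in>bool_lists n (Suc t). gap_prod \<alpha> bs) \<le> gap_weight \<sigma> t n (Suc t)"
    if "\<And>n. (\<Sum>bs\<in>bool_lists n t. gap_prod \<alpha> (True # bs)) \<le> gap_weight \<sigma> t n t" for t n
  proof (induction n)
    case 0
    then show ?case using gap_weight_nonneg[OF \<sigma>0] by (simp add: bool_lists_0_left)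
  next
    case (Suc n)
    have "(\<Sum>bs\<in>bool_lists (Suc n) (Suc t). gap_prod \<alpha> bs)
        \<le> gap_weight \<sigma> t n (Suc t) + gap_weight \<sigma> t n t"
      unfolding sum_bool_lists_Suc using Suc that[of n] by (intro add_mono) auto
    also have "\<dots> \<le> gap_weight \<sigma> t (Suc n) (Suc t)"
      by (rule gap_weight_pascal[OF \<sigma>0])
    finally show ?case .
  qed
  {
    case 0
    show *: "(\<Sum>bs\<in>bool_lists n 0. gap_prod \<alpha> (True # bs)) \<le> gap_weight \<sigma> 0 n 0" for n
      by (simp add: bool_lists_0_right)
    show "(\<Sum>bs\<in>bool_lists n (Suc 0). gap_prod \<alpha> bs) \<le> gap_weight \<sigma> 0 n (Suc 0)" for n
      by (rule total[OF *])
  next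
    case (Suc t)
    have *: "(\<Sum>bs\<in>bool_lists n (Suc t). gap_prod \<alpha> (True # bs)) \<le> gap_weight \<sigma> (Suc t) n (Suc t)" for n
    proof (cases n)
      case 0
      then show ?thesis using gap_weight_nonneg[OF \<sigma>0] by (simp add: bool_lists_0_left)
    next
      case (Suc n')
      have "(\<Sum>bs\<in>bool_lists n (Suc t). carry \<alpha> 0 bs / \<alpha> * gap_prod \<alpha> bs)
          \<le> \<sigma> * gap_weight \<sigma> t n' t"
      proof (rule sum_carry_le_gap_weight[OF \<alpha> \<sigma> gap_weight_nonneg[OF \<sigma>0]])
        fix k assume "k < n"
        then show "(\<Sum>bs\<in>bool_lists k t. gap_prod \<alpha> (True # bs)) \<le> gap_weight \<sigma> t n' t"
          using Suc.IH(2)[of k] gap_weight_mono[OF \<sigma>0, of k n' t t] Suc by linarith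
      qed simp
      then show ?thesis
        using Suc.IH(1)[of n] Suc by (simp add: algebra_simps sum.distrib)
    qed
    show "(\<Sum>bs\<in>bool_lists n (Suc t). gap_prod \<alpha> (True # bs)) \<le> gap_weight \<sigma> (Suc t) n (Suc t)" for n
      by (rule *)
    show "(\<Sum>bs\<in>bool_lists n (Suc (Suc t)). gap_prod \<alpha> bs) \<le> gap_weight \<sigma> (Suc t) n (Suc (Suc t))" for n
      by (rule total[OF *])
  }
qed

text \<open>Each of the \<open>t\<close> gaps contributes at most \<sigma> times the number of words
  left when the gap is contracted and its two marks merge, which is \<open>n choose t\<close>. The
  induction splits by the first letter and adds up by Pascal's rule.\<close>

lemma sum_gap_sum_le:
  assumes \<alpha>: "0 < \<alpha>" "\<alpha> \<le> 1" and \<sigma>: "\<sigma> = 2 / \<alpha>\<^sup>2"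
  shows "(\<Sum>bs\<in>bool_lists (Suc n) (Suc t). gap_sum \<alpha> bs) \<le> real t * \<sigma> * real (n choose t)"
proof (induction n arbitrary: t)
  case 0
  then show ?case using \<sigma> by (simp add: sum_bool_lists_Suc bool_lists_0_left)
next
  case (Suc n)
  show ?case
  proof (cases t)
    case 0
    then show ?thesis using Suc[of 0]
      by (subst sum_bool_lists_Suc) (simp add: bool_lists_0_right)
  next
    case t: (Suc t')
    have "(\<Sum>bs\<in>bool_lists (Suc n) (Suc t'). carry \<alpha> 0 bs / \<alpha> * 1) \<le> \<sigma> * real (n choose t')"
    proof (rule sum_carry_le_gap_weight[OF \<alpha> \<sigma>])
      fix k assume "k < Suc n"
      then show "(\<Sum>bs\<in>bool_lists k t'. 1) \<le> real (n choose t')"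
        by (simp add: card_bool_lists binomial_right_mono)
    qed auto
    then have "(\<Sum>bs\<in>bool_lists (Suc (Suc n)) (Suc t). gap_sum \<alpha> bs)
      \<le> real t * \<sigma> * real (n choose t) + (\<sigma> * real (n choose t') + real t' * \<sigma> * real (n choose t'))"
      using Suc[of t] Suc[of t'] t by (subst sum_bool_lists_Suc) (simp add: sum.distrib)
    also have "\<dots> = real t * \<sigma> * real (Suc n choose t)"
      using t by (simp add: algebra_simps)
    finally show ?thesis .
  qed
qed

section \<open>Uniformly random subsets\<close>

text \<open>Glue a bijection from \<open>A\<close> to \<open>B\<close> with one between their
  complements in \<open>S\<close>.\<close>

lemma permutes_image_eq_exists:
  assumes "finite S" "A \<subseteq> S" "B \<subseteq> S" "card A = card B"
  obtains \<sigma> where "\<sigma> permutes S" "\<sigma> ` A = B"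
proof -
  have fin: "finite A" "finite B" "finite (S - A)" "finite (S - B)"
    using assms finite_subset by auto
  obtain f where f: "bij_betw f A B"
    using finite_same_card_bij[OF fin(1,2) assms(4)] by blast
  have "card (S - A) = card (S - B)"
    using assms fin by (simp add: card_Diff_subset)
  then obtain g where g: "bij_betw g (S - A) (S - B)"
    using finite_same_card_bij[OF fin(3,4)] by blast
  define \<sigma> where "\<sigma> = (\<lambda>x. if x \<in> S then if x \<in> A then f x else g x else x)"
  have fA: "bij_betw \<sigma> A B"
    using f assms(2) by (subst bij_betw_cong[of A \<sigma> f]) (auto simp: \<sigma>_def)
  have gA: "bij_betw \<sigma> (S - A) (S - B)"
    using g by (subst bij_betw_cong[of "S - A" \<sigma> g]) (auto simp: \<sigma>_def)
  have "bij_betw \<sigma> (A \<union> (S - A)) (B \<union> (S - B))"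
    using fA gA by (rule bij_betw_combine) auto
  then have "bij_betw \<sigma> S S"
    using assms(2,3) by (simp add: Un_absorb1 Un_Diff_cancel)
  then have "\<sigma> permutes S"
    by (rule bij_imp_permutes) (simp add: \<sigma>_def)
  with that fA show thesis by (auto simp: bij_betw_def)
qed

text \<open>Composition with a permutation carrying \<open>A\<close> to \<open>B\<close> is a
  bijection between the two sets.\<close>

lemma card_permutes_image_eq:
  assumes "finite S" "A \<subseteq> S" "B \<subseteq> S" "card A = card B"
  shows "card {\<pi>. \<pi> permutes S \<and> \<pi> ` A = B} = card {\<pi>. \<pi> permutes S \<and> \<pi> ` A = A}"
proof -
  obtain \<sigma> where \<sigma>: "\<sigma> permutes S" "\<sigma> ` A = B"
    using permutes_image_eq_exists[OF assms] by blast
  have inv: "inv \<sigma> ` B = A"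
    using \<sigma> permutes_inj[OF \<sigma>(1)] by (metis image_inv_f_f)
  have "bij_betw (\<lambda>\<pi>. \<sigma> \<circ> \<pi>) {\<pi>. \<pi> permutes S \<and> \<pi> ` A = A} {\<pi>. \<pi> permutes S \<and> \<pi> ` A = B}"
  proof (rule bij_betw_byWitness[where f' = "\<lambda>\<pi>. inv \<sigma> \<circ> \<pi>"])
    show "\<forall>\<pi>\<in>{\<pi>. \<pi> permutes S \<and> \<pi> ` A = A}. inv \<sigma> \<circ> (\<sigma> \<circ> \<pi>) = \<pi>"
      using permutes_inv_o(2)[OF \<sigma>(1)] by (simp flip: comp_assoc)
    show "\<forall>\<pi>\<in>{\<pi>. \<pi> permutes S \<and> \<pi> ` A = B}. \<sigma> \<circ> (inv \<sigma> \<circ> \<pi>) = \<pi>"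
      using permutes_inv_o(1)[OF \<sigma>(1)] by (simp flip: comp_assoc)
    show "(\<lambda>\<pi>. \<sigma> \<circ> \<pi>) ` {\<pi>. \<pi> permutes S \<and> \<pi> ` A = A} \<subseteq> {\<pi>. \<pi> permutes S \<and> \<pi> ` A = B}"
      using \<sigma> by (intro image_subsetI) (simp add: permutes_compose, metis image_image)
    show "(\<lambda>\<pi>. inv \<sigma> \<circ> \<pi>) ` {\<pi>. \<pi> permutes S \<and> \<pi> ` A = B} \<subseteq> {\<pi>. \<pi> permutes S \<and> \<pi> ` A = A}"
      using inv permutes_inv[OF \<sigma>(1)] by (intro image_subsetI) (simp add: permutes_compose, metis image_image)
  qed
  then show ?thesis by (simp add: bij_betw_same_card)
qed

text \<open>The image of \<open>A\<close> under a uniformly random permutation is a uniformly random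
  subset of the same size, as each such subset is hit by the same number \<open>N\<close> of
  permutations.\<close>

lemma average_permutes_image:
  fixes g :: "'a set \<Rightarrow> real"
  assumes "finite S" "A \<subseteq> S"
  shows "(\<Sum>\<pi> | \<pi> permutes S. g (\<pi> ` A)) / fact (card S)
    = (\<Sum>B | B \<subseteq> S \<and> card B = card A. g B) / real (card S choose card A)"
proof -
  define N where "N = card {\<pi>. \<pi> permutes S \<and> \<pi> ` A = A}"
  have sum_eq: "(\<Sum>\<pi> | \<pi> permutes S. h (\<pi> ` A)) = real N * (\<Sum>B | B \<subseteq> S \<and> card B = card A. h B)"
    for h :: "'a set \<Rightarrow> real"
  proof -
    have im: "(\<lambda>\<pi>. \<pi> ` A) ` {\<pi>. \<pi> permutes S} \<subseteq> {B. B \<subseteq> S \<and> card B = card A}"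
      using assms(2) by (auto simp: permutes_in_image intro!: card_image permutes_inj_on)
    have "(\<Sum>\<pi> | \<pi> permutes S. h (\<pi> ` A))
      = (\<Sum>B | B \<subseteq> S \<and> card B = card A. \<Sum>\<pi> | \<pi> \<in> {\<pi>. \<pi> permutes S} \<and> \<pi> ` A = B. h (\<pi> ` A))"
      using assms(1) by (intro sum.group[symmetric] im finite_permutations) simp_all
    also have "\<dots> = (\<Sum>B | B \<subseteq> S \<and> card B = card A. real N * h B)"
      using card_permutes_image_eq[OF assms] by (intro sum.cong) (auto simp: N_def)
    finally show ?thesis by (simp add: sum_distrib_left)
  qed
  \<comment> \<open>The constant function 1 determines \<open>N\<close>.\<close>
  have "fact (card S) = real N * real (card S choose card A)"
    using sum_eq[of "\<lambda>_. 1"] assms(1) by (simp add: card_permutations n_subsets)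
  moreover have "real N \<noteq> 0"
    using calculation by (metis fact_nonzero mult_zero_left)
  ultimately show ?thesis by (simp add: sum_eq)
qed

text \<open>Subsets correspond to their indicator words; positions count from 1, list indices from
  0.\<close>

lemma bij_betw_subsets_bool_lists:
  "bij_betw (\<lambda>B. map (\<lambda>m. m \<in> B) [1..<Suc n]) {B. B \<subseteq> {1..n} \<and> card B = t} (bool_lists n t)"
proof (rule bij_betw_byWitness[where f' = "\<lambda>bs. {m \<in> {1..n}. bs ! (m - 1)}"])
  have count: "count_list (map (\<lambda>m. m \<in> B) [1..<Suc n]) True = card (B \<inter> {1..n})" for B :: "nat set"
  proof -
    have "count_list (map (\<lambda>m. m \<in> B) [1..<Suc n]) True = length (filter (\<lambda>m. m \<in> B) [1..<Suc n])"
      by (simp add: count_list_eq_length_filter filter_map comp_def del: upt_Suc)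
    also have "\<dots> = card (set (filter (\<lambda>m. m \<in> B) [1..<Suc n]))"
      by (intro distinct_card[symmetric]) simp
    also have "set (filter (\<lambda>m. m \<in> B) [1..<Suc n]) = B \<inter> {1..n}"
      by auto
    finally show ?thesis .
  qed
  have list: "map (\<lambda>m. m \<in> {m \<in> {1..n}. bs ! (m - 1)}) [1..<Suc n] = bs"
    if "length bs = n" for bs
    using that by (intro nth_equalityI) (auto simp del: upt_Suc)
  have "map (\<lambda>m. m \<in> B) [1..<Suc n] ! (m - 1) \<longleftrightarrow> m \<in> B" if "m \<in> {1..n}" for B :: "nat set" and m
    using that by (subst nth_map) (auto simp del: upt_Suc)
  then show "\<forall>B\<in>{B. B \<subseteq> {1..n} \<and> card B = t}.
      {m \<in> {1..n}. map (\<lambda>m. m \<in> B) [1..<Suc n] ! (m - 1)} = B"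
    by blast
  show "\<forall>bs\<in>bool_lists n t. map (\<lambda>m. m \<in> {m \<in> {1..n}. bs ! (m - 1)}) [1..<Suc n] = bs"
    using list by (auto simp: bool_lists_def simp del: upt_Suc)
  show "(\<lambda>B. map (\<lambda>m. m \<in> B) [1..<Suc n]) ` {B. B \<subseteq> {1..n} \<and> card B = t} \<subseteq> bool_lists n t"
    using count by (auto simp: bool_lists_def Int_absorb2 simp del: upt_Suc)
  show "(\<lambda>bs. {m \<in> {1..n}. bs ! (m - 1)}) ` bool_lists n t \<subseteq> {B. B \<subseteq> {1..n} \<and> card B = t}"
  proof safe
    fix bs assume bs: "bs \<in> bool_lists n t"
    have "card ({m \<in> {1..n}. bs ! (m - 1)} \<inter> {1..n}) = t"
      unfolding count[symmetric] using bs list[of bs] by (auto simp: bool_lists_def simp del: upt_Suc)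
    moreover have "{m \<in> {1..n}. bs ! (m - 1)} \<inter> {1..n} = {m \<in> {1..n}. bs ! (m - 1)}"
      by auto
    ultimately show "card {m \<in> {1..n}. bs ! (m - 1)} = t"
      by simp
  qed
qed

text \<open>Letter \<open>m\<close> tells whether the index at position \<open>m\<close> of the
  \<pi>-order lies in \<open>I\<close>. The word is therefore the indicator of the image of
  \<open>I\<close> under \<pi>, a uniformly random subset.\<close>

lemma average_permutes_pattern:
  fixes h :: "bool list \<Rightarrow> real"
  assumes "I \<subseteq> {1..n}"
  shows "(\<Sum>\<pi> | \<pi> permutes {1..n}. h (map (\<lambda>m. inv \<pi> m \<in> I) [1..<Suc n])) / fact n
    = (\<Sum>bs\<in>bool_lists n (card I). h bs) / real (n choose card I)"
proof -
  have "(\<Sum>\<pi> | \<pi> permutes {1..n}. h (map (\<lambda>m. inv \<pi> m \<in> I) [1..<Suc n]))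
      = (\<Sum>\<pi> | \<pi> permutes {1..n}. h (map (\<lambda>m. m \<in> \<pi> ` I) [1..<Suc n]))"
  proof (intro sum.cong refl arg_cong[of _ _ h] map_cong)
    fix \<pi> m assume "\<pi> \<in> {\<pi>. \<pi> permutes {1..n}}"
    then have "\<pi> permutes {1..n}" by simp
    then show "(inv \<pi> m \<in> I) = (m \<in> \<pi> ` I)"
      by (metis image_iff permutes_inverses(1,2))
  qed
  then show ?thesis
    using average_permutes_image[OF _ assms, of "\<lambda>B. h (map (\<lambda>m. m \<in> B) [1..<Suc n])"]
      sum.reindex_bij_betw[OF bij_betw_subsets_bool_lists, of h n "card I"]
    by (simp del: upt_Suc)
qed

lemma average_gap_prod_le:
  assumes \<alpha>: "0 < \<alpha>" "\<alpha> \<le> 1" and I: "I \<subseteq> {1..n}" and t: "card I = Suc t"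
  shows "(\<Sum>\<pi> | \<pi> permutes {1..n}. gap_prod \<alpha> (map (\<lambda>m. inv \<pi> m \<in> I) [1..<Suc n])) / fact n
    \<le> (1 + 2 / \<alpha>\<^sup>2 * real (Suc t) / real n) ^ t"
proof -
  have tn: "Suc t \<le> n"
    using card_mono[OF _ I] t by simp
  then have pos: "0 < real (n choose Suc t)" by simp
  have "(\<Sum>bs\<in>bool_lists n (Suc t). gap_prod \<alpha> bs)
      \<le> real (n choose Suc t) * (1 + 2 / \<alpha>\<^sup>2 * real (Suc t) / real n) ^ t"
    using sum_gap_prod_le(1)[OF \<alpha> refl, of n t] gap_weight_le[OF _ tn, of "2 / \<alpha>\<^sup>2" t] by simp
  then show ?thesis
    unfolding average_permutes_pattern[OF I] t using pos
    by (simp add: pos_divide_le_eq mult.commute del: binomial_Suc_Suc)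
qed

lemma average_gap_sum_le:
  assumes \<alpha>: "0 < \<alpha>" "\<alpha> \<le> 1" and I: "I \<subseteq> {1..n}" and t: "card I = Suc t"
  shows "(\<Sum>\<pi> | \<pi> permutes {1..n}. gap_sum \<alpha> (map (\<lambda>m. inv \<pi> m \<in> I) [1..<Suc n])) / fact n
    \<le> 2 / \<alpha>\<^sup>2 * real t * real (Suc t) / real n"
proof -
  have tn: "Suc t \<le> n"
    using card_mono[OF _ I] t by simp
  then have pos: "0 < real (n choose Suc t)" by simp
  have "real (Suc t) * real (n choose Suc t) = real n * real (n - 1 choose t)"
    using times_binomial_minus1_eq[of "Suc t" n] by (simp flip: of_nat_mult del: of_nat_Suc binomial_Suc_Suc)
  then have binom: "real (n - 1 choose t) = real (n choose Suc t) * (real (Suc t) / real n)"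
    using tn by (simp add: field_simps del: of_nat_Suc binomial_Suc_Suc)
  have "(\<Sum>bs\<in>bool_lists n (Suc t). gap_sum \<alpha> bs) \<le> real t * (2 / \<alpha>\<^sup>2) * real (n - 1 choose t)"
    using sum_gap_sum_le[OF \<alpha> refl, of "n - 1" t] tn by simp
  then show ?thesis
    unfolding average_permutes_pattern[OF I] t binom using pos
    by (simp add: pos_divide_le_eq mult_ac del: binomial_Suc_Suc of_nat_Suc)
qed

section \<open>A single step of DepRound\<close>

text \<open>This is exactly the third branch of \<open>simplify\<close>, since it excludes the two
  earlier conditions. There both outcomes leave the first entry fractional.\<close>

definition case_III :: "real \<Rightarrow> real \<Rightarrow> real \<Rightarrow> real \<Rightarrow> bool" where
  "case_III a1 a2 \<beta>1 \<beta>2 \<longleftrightarrow> a2 < a1 * \<beta>1 + a2 * \<beta>2 \<and> a1 * \<beta>1 + a2 * \<beta>2 < a1"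

text \<open>Collects what the analysis needs of \<open>simplify\<close> when the second entry is
  still at \<open>p\<close>. Outside Case III the first entry survives with probability at most
  \<open>max p (1 - p)\<close>; in Case III its two new values are recorded, in order to exclude a
  repetition.\<close>

lemma simplify_two_point:
  assumes a: "0 < a1" "0 < a2" and x: "0 < x" "x < 1" and p: "0 < p" "p < 1"
  obtains q u1 v1 u2 v2 where
    "simplify a1 a2 x p = map_pmf (\<lambda>c. if c then (u1, v1) else (u2, v2)) (bernoulli_pmf q)"
    "0 \<le> q" "q \<le> 1"
    "0 \<le> u1" "u1 \<le> 1" "0 \<le> v1" "v1 \<le> 1" "0 \<le> u2" "u2 \<le> 1" "0 \<le> v2" "v2 \<le> 1"
    "u1 \<in> {0, 1} \<or> v1 \<in> {0, 1}" "u2 \<in> {0, 1} \<or> v2 \<in> {0, 1}"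
    "q * u1 + (1 - q) * u2 = x" "q * v1 + (1 - q) * v2 = p"
    "case_III a1 a2 x p \<Longrightarrow>
      a1 * u1 = a1 * x + a2 * p - a2 \<and> a1 * u2 = a1 * x + a2 * p"
    "\<not> case_III a1 a2 x p \<Longrightarrow>
      q * of_bool (0 < u1 \<and> u1 < 1) + (1 - q) * of_bool (0 < u2 \<and> u2 < 1) \<le> max p (1 - p)"
proof -
  define s where "s = a1 * x + a2 * p"
  have s0: "0 < s" using assms by (simp add: s_def add_pos_pos)
  have pos: "0 < a1 * x" "0 < a2 * p" "0 < a1 * (1 - x)" "0 < a2 * (1 - p)"
    using assms by auto
  consider (I) "s \<le> min a1 a2" | (II) "a1 < s" "s < a2" | (III) "a2 < s" "s < a1"
    | (IV) "\<not> s \<le> min a1 a2" "\<not> (a1 < s \<and> s < a2)" "\<not> (a2 < s \<and> s < a1)"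
    by blast
  then show thesis
  proof cases
    case I
    let ?q = "a2 * p / s"
    have q: "1 - ?q = a1 * x / s" using s0 by (simp add: s_def field_simps)
    have v: "p + x * a1 / a2 = s / a2" and u: "x + p * a2 / a1 = s / a1"
      using a by (auto simp: s_def field_simps)
    show thesis
    proof (rule that[of 0 "s / a2" "s / a1" 0 ?q])
      show "simplify a1 a2 x p = map_pmf (\<lambda>c. if c then (0, s / a2) else (s / a1, 0)) (bernoulli_pmf ?q)"
        using I by (simp add: simplify_def s_def[symmetric] v u)
      show "0 \<le> ?q" using s0 pos by simp
      show "?q \<le> 1" using s0 pos by (simp add: s_def)
      show "?q * 0 + (1 - ?q) * (s / a1) = x" "?q * (s / a2) + (1 - ?q) * 0 = p"
        unfolding q using s0 a by auto
      \<comment> \<open>By \<open>s \<le> a2\<close>; so the first entry survives with probability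
        at most \<open>1 - p\<close>.\<close>
      have "p \<le> ?q"
        using I s0 p mult_right_mono[of s a2 p] by (simp add: pos_le_divide_eq mult.commute)
      then show "?q * of_bool (0 < (0::real) \<and> (0::real) < 1)
          + (1 - ?q) * of_bool (0 < s / a1 \<and> s / a1 < 1) \<le> max p (1 - p)"
        using p by (auto simp: of_bool_def)
      show "a1 * 0 = a1 * x + a2 * p - a2 \<and> a1 * (s / a1) = a1 * x + a2 * p" if "case_III a1 a2 x p"
        using that I by (auto simp: case_III_def s_def)
    qed (use I s0 a in auto)
  next
    case II
    have v0: "p + x * a1 / a2 = s / a2" and v1: "p - (1 - x) * a1 / a2 = (s - a1) / a2"
      using a by (auto simp: s_def field_simps)
    show thesis
    proof (rule that[of 1 "(s - a1) / a2" 0 "s / a2" x])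
      show "simplify a1 a2 x p = map_pmf (\<lambda>c. if c then (1, (s - a1) / a2) else (0, s / a2)) (bernoulli_pmf x)"
        using II by (simp add: simplify_def s_def[symmetric] v0 v1)
      show "x * ((s - a1) / a2) + (1 - x) * (s / a2) = p"
        using a by (simp add: s_def field_simps)
      show "a1 * 1 = a1 * x + a2 * p - a2 \<and> a1 * 0 = a1 * x + a2 * p" if "case_III a1 a2 x p"
        using that II by (auto simp: case_III_def s_def)
    qed (use II s0 a x p in auto)
  next
    case III
    have u0: "x + p * a2 / a1 = s / a1" and u1: "x - (1 - p) * a2 / a1 = (s - a2) / a1"
      using a by (auto simp: s_def field_simps)
    show thesis
    proof (rule that[of "(s - a2) / a1" 1 "s / a1" 0 p])
      show "simplify a1 a2 x p = map_pmf (\<lambda>c. if c then ((s - a2) / a1, 1) else (s / a1, 0)) (bernoulli_pmf p)"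
        using III by (simp add: simplify_def s_def[symmetric] u0 u1)
      show "p * ((s - a2) / a1) + (1 - p) * (s / a1) = x"
        using a by (simp add: s_def field_simps)
      show "a1 * ((s - a2) / a1) = a1 * x + a2 * p - a2 \<and> a1 * (s / a1) = a1 * x + a2 * p"
        using a by (simp add: s_def)
      show "p * of_bool (0 < (s - a2) / a1 \<and> (s - a2) / a1 < 1)
          + (1 - p) * of_bool (0 < s / a1 \<and> s / a1 < 1) \<le> max p (1 - p)" if "\<not> case_III a1 a2 x p"
        using that III by (auto simp: case_III_def s_def)
    qed (use III s0 a x p in auto)
  next
    case IV
    \<comment> \<open>\<open>D\<close> is \<open>s\<close> for the complementary entries
      \<open>1 - x\<close> and \<open>1 - p\<close>: Case IV mirrors Case I.\<close>
    define D where "D = a1 * (1 - x) + a2 * (1 - p)"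
    let ?q = "a2 * (1 - p) / D"
    have D0: "0 < D" using pos by (simp add: D_def add_pos_pos)
    have sD: "D = a1 + a2 - s" by (simp add: D_def s_def algebra_simps)
    have s: "a1 \<le> s" "a2 \<le> s" using IV by auto
    have q: "1 - ?q = a1 * (1 - x) / D" using D0 by (simp add: D_def field_simps)
    have v: "p - (1 - x) * a1 / a2 = 1 - D / a2" and u: "x - (1 - p) * a2 / a1 = 1 - D / a1"
      using a by (auto simp: D_def field_simps)
    show thesis
    proof (rule that[of 1 "1 - D / a2" "1 - D / a1" 1 ?q])
      show "simplify a1 a2 x p = map_pmf (\<lambda>c. if c then (1, 1 - D / a2) else (1 - D / a1, 1)) (bernoulli_pmf ?q)"
        using IV by (auto simp: simplify_def Let_def s_def[symmetric] D_def[symmetric] v u)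
      show "0 \<le> ?q" using D0 pos by simp
      show "?q \<le> 1" using D0 pos by (simp add: D_def)
      have mix: "c * 1 + (1 - c) * (1 - d) = 1 - (1 - c) * d" "c * (1 - d) + (1 - c) * 1 = 1 - c * d"
        for c d :: real
        by (simp_all add: algebra_simps)
      show "?q * 1 + (1 - ?q) * (1 - D / a1) = x" "?q * (1 - D / a2) + (1 - ?q) * 1 = p"
        unfolding mix unfolding q using D0 a by simp_all
      \<comment> \<open>By \<open>a1 \<le> s\<close>, that is, \<open>D \<le> a2\<close>.\<close>
      have "1 - p \<le> ?q"
        using s sD D0 p mult_right_mono[of D a2 "1 - p"] by (simp add: pos_le_divide_eq mult.commute)
      then show "?q * of_bool (0 < (1::real) \<and> (1::real) < 1)
          + (1 - ?q) * of_bool (0 < 1 - D / a1 \<and> 1 - D / a1 < 1) \<le> max p (1 - p)"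
        using p by (auto simp: of_bool_def)
      show "a1 * 1 = a1 * x + a2 * p - a2 \<and> a1 * (1 - D / a1) = a1 * x + a2 * p" if "case_III a1 a2 x p"
        using that s by (auto simp: case_III_def s_def)
    qed (use s sD D0 a in auto)
  qed
qed

lemma expectation_bind_map_bernoulli:
  fixes h :: "'b \<Rightarrow> real"
  assumes "\<And>x. finite (set_pmf (F x))" "0 \<le> q" "q \<le> 1"
  shows "measure_pmf.expectation (bind_pmf (map_pmf g (bernoulli_pmf q)) F) h
    = q * measure_pmf.expectation (F (g True)) h + (1 - q) * measure_pmf.expectation (F (g False)) h"
  using assms unfolding bind_map_pmf
  by (subst pmf_expectation_bind[of UNIV]) (auto simp: UNIV_bool)

lemma finite_set_pmf_simplify [simp]: "finite (set_pmf (simplify a1 a2 \<beta>1 \<beta>2))"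
  by (simp add: simplify_def Let_def)

lemma finite_set_pmf_depround_loop [simp]: "finite (set_pmf (depround_loop n a \<pi> X))"
proof (induction n a \<pi> X rule: depround_loop.induct)
  case (1 n a \<pi> X)
  show ?case
    by (subst depround_loop.simps) (auto split: prod.splits intro: 1)
qed

text \<open>Strict sorting makes \<pi> injective on the list, so each \<open>arg_min\<close> is the
  head of what remains.\<close>

lemma first_two_fractional_sorted:
  assumes "sorted_wrt (\<lambda>k l. \<pi> k < \<pi> l) (i # j # L)" "set (i # j # L) = fractional n X"
  shows "first_two_fractional n \<pi> X = (i, j)"
proof -
  have inj: "inj_on \<pi> (set xs)" if "sorted_wrt (\<lambda>k l. \<pi> k < \<pi> l) xs" for xs
    using that by (induction xs) (auto simp: inj_on_insert)
  have sorted_tl: "sorted_wrt (\<lambda>k l. \<pi> k < \<pi> l) (j # L)" using assms(1) by simp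
  have notin: "i \<noteq> j" "i \<notin> set L" using assms(1) by auto
  have "arg_min \<pi> (\<lambda>k. k \<in> fractional n X) = i"
    unfolding assms(2)[symmetric]
  proof (rule arg_min_inj_eq)
    show "inj_on \<pi> {k. k \<in> set (i # j # L)}"
      using inj[OF assms(1)] by (simp only: Collect_mem_eq)
  qed (use assms(1) in auto)
  moreover have "fractional n X - {i} = set (j # L)"
    unfolding assms(2)[symmetric] using notin by auto
  then have "arg_min \<pi> (\<lambda>k. k \<in> fractional n X - {i}) = j"
  proof (simp only:, intro arg_min_inj_eq)
    show "inj_on \<pi> {k. k \<in> set (j # L)}"
      using inj[OF sorted_tl] by (simp only: Collect_mem_eq)
  qed (use assms(1) in auto)
  ultimately show ?thesis by (simp add: first_two_fractional_def)
qed

section \<open>Potentials that bound the accumulated error\<close>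

locale depround_setting =
  fixes n :: nat and p \<alpha> :: real and a :: "nat \<Rightarrow> real" and Iplus Iminus :: "nat set"
  assumes p: "0 < p" "p < 1" and \<alpha>: "\<alpha> = min p (1 - p)"
    and a_pos: "\<And>i. i \<in> {1..n} \<Longrightarrow> 0 < a i"
    and a_ratio: "\<And>i j. i \<in> {1..n} \<Longrightarrow> j \<in> {1..n} \<Longrightarrow> a i \<le> (1 + \<alpha>) * a j"
    and disjoint: "Iplus \<inter> Iminus = {}"
begin

text \<open>The value 1 outside \<open>Iplus\<close> and \<open>Iminus\<close> lets products run
  over all of \<open>{1..n}\<close>.\<close>

definition signed :: "nat \<Rightarrow> real \<Rightarrow> real" where
  "signed k z = (if k \<in> Iplus then z else if k \<in> Iminus then 1 - z else 1)"

definition signed_prod :: "(nat \<Rightarrow> real) \<Rightarrow> real" where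
  "signed_prod X = (\<Prod>k\<in>{1..n}. signed k (X k))"

definition chosen :: "nat list \<Rightarrow> bool list" where
  "chosen xs = map (\<lambda>k. k \<in> Iplus \<union> Iminus) xs"

definition indep_prod :: "nat list \<Rightarrow> real" where
  "indep_prod xs = prod_list (map (\<lambda>k. signed k p) xs)"

text \<open>In Case III the current entry survives with certainty. Since \<open>a\<^sub>m\<^sub>a\<^sub>x / a\<^sub>m\<^sub>i\<^sub>n \<le> 1 + \<alpha>\<close>, this
  cannot happen twice in a row; an entry is fresh if Case III is excluded for its next step.\<close>

definition fresh :: "nat \<Rightarrow> real \<Rightarrow> bool" where
  "fresh i x \<longleftrightarrow> (\<forall>k\<in>{1..n}. \<not> case_III (a i) (a k) x p)"

text \<open>A fresh entry starts the count at 1, so its next step already costs a factor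
  \<open>1 - \<alpha>\<close>; any other entry gets one step free of charge, possibly in Case III.
  An unmarked entry has a constant factor and carries no error.\<close>

definition carried :: "nat \<Rightarrow> real \<Rightarrow> nat list \<Rightarrow> real" where
  "carried i x L =
    (if i \<in> Iplus \<union> Iminus then carry \<alpha> (of_bool (fresh i x)) (chosen L) else 0)"

text \<open>The list holds the fractional entries in \<pi>-order. Only its head may have been
  processed, and the possible loss is added to its factor; the tail is still at
  \<open>p\<close>.\<close>

fun upper :: "(nat \<Rightarrow> real) \<Rightarrow> nat list \<Rightarrow> real" where
  "upper X [] = 1"
| "upper X (i # L) =
    (signed i (X i) + carried i (X i) L) * (indep_prod L * gap_prod \<alpha> (chosen L))"

text \<open>Losses are subtracted, so this bound may be negative; then nonnegativity of the
  expectation takes over.\<close>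

fun lower :: "(nat \<Rightarrow> real) \<Rightarrow> nat list \<Rightarrow> real" where
  "lower X [] = 1"
| "lower X (i # L) =
    (signed i (X i) * (1 - gap_sum \<alpha> (chosen L)) - carried i (X i) L) * indep_prod L"

lemma \<alpha>_bounds: "0 < \<alpha>" "\<alpha> \<le> 1" "\<alpha> \<le> p" "\<alpha> \<le> 1 - p"
  using p \<alpha> by auto

lemma chosen_simps [simp]:
  "chosen [] = []" "chosen (k # xs) = (k \<in> Iplus \<union> Iminus) # chosen xs"
  by (simp_all add: chosen_def)

lemma indep_prod_simps [simp]:
  "indep_prod [] = 1" "indep_prod (k # xs) = signed k p * indep_prod xs"
  by (simp_all add: indep_prod_def)

lemma signed_outside [simp]: "k \<notin> Iplus \<union> Iminus \<Longrightarrow> signed k z = 1"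
  by (simp add: signed_def)

lemma signed_bounds:
  assumes "0 \<le> z" "z \<le> 1"
  shows "0 \<le> signed k z" "signed k z \<le> 1"
  using assms by (auto simp: signed_def)

lemma signed_p_ge: "\<alpha> \<le> signed k p"
  using \<alpha>_bounds by (auto simp: signed_def)

lemma signed_convex:
  assumes "q * u1 + (1 - q) * u2 = x"
  shows "q * signed k u1 + (1 - q) * signed k u2 = signed k x"
  using assms by (auto simp: signed_def algebra_simps)

lemma indep_prod_nonneg: "0 \<le> indep_prod xs"
  using signed_bounds[of p] p by (induction xs) auto

lemma carry_\<alpha>_nonneg: "0 \<le> carry \<alpha> m bs"
  using \<alpha>_bounds by (simp add: carry_nonneg)

lemma carried_bounds:
  shows "0 \<le> carried i x L" "carried i x L \<le> carry \<alpha> 0 (chosen L)"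
  using carry_Suc_le[of \<alpha> 0 "chosen L"] \<alpha>_bounds carry_\<alpha>_nonneg
  by (auto simp: carried_def of_bool_def)

lemma carried_le_signed_p: "carried i x L \<le> signed i p * (carry \<alpha> 0 (chosen L) / \<alpha>)"
proof -
  have "1 \<le> signed i p / \<alpha>" using \<alpha>_bounds signed_p_ge[of i] by simp
  from mult_right_mono[OF this carry_\<alpha>_nonneg[of 0 "chosen L"]]
  show ?thesis using carried_bounds[of i x L] by simp
qed

text \<open>With the head at \<open>p\<close> as well, its loss is absorbed into its own gap factor.
  This serves at the start and whenever a step rounds both of its entries.\<close>

lemma upper_le:
  assumes "\<forall>k\<in>set xs. X k = p"
  shows "upper X xs \<le> indep_prod xs * gap_prod \<alpha> (chosen xs)"
proof (cases xs)
  case (Cons i L)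
  have "signed i p + carried i p L \<le> signed i p * (if i \<in> Iplus \<union> Iminus then 1 + carry \<alpha> 0 (chosen L) / \<alpha> else 1)"
    using carried_le_signed_p[of i p L] by (auto simp: algebra_simps carried_def)
  moreover have "0 \<le> indep_prod L * gap_prod \<alpha> (chosen L)"
    using indep_prod_nonneg gap_prod_ge_1[of \<alpha> "chosen L"] \<alpha>_bounds by simp
  ultimately have "(signed i p + carried i p L) * (indep_prod L * gap_prod \<alpha> (chosen L))
      \<le> signed i p * (if i \<in> Iplus \<union> Iminus then 1 + carry \<alpha> 0 (chosen L) / \<alpha> else 1)
        * (indep_prod L * gap_prod \<alpha> (chosen L))"
    by (rule mult_right_mono)
  then show ?thesis
    using assms Cons by (simp add: mult_ac)
qed simp

lemma lower_ge:
  assumes "\<forall>k\<in>set xs. X k = p"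
  shows "indep_prod xs * (1 - gap_sum \<alpha> (chosen xs)) \<le> lower X xs"
proof (cases xs)
  case (Cons i L)
  have "signed i p * (1 - gap_sum \<alpha> (chosen (i # L))) \<le> signed i p * (1 - gap_sum \<alpha> (chosen L)) - carried i p L"
    using carried_le_signed_p[of i p L] by (auto simp: algebra_simps carried_def)
  from mult_right_mono[OF this indep_prod_nonneg] show ?thesis
    using assms Cons by (simp add: mult_ac)
qed simp

text \<open>After the step, \<open>a i * u\<close> is either below \<open>a i - a j\<close> or above
  \<open>a j\<close>. Another Case III, with weight \<open>a k\<close>, would force it strictly
  between \<open>\<alpha> * a k\<close> and \<open>a i - \<alpha> * a k\<close>. Either way
  \<open>a i > a j + \<alpha> * a k\<close>, against the ratio bound.\<close>

lemma fresh_after_case_III: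
  assumes ij: "i \<in> {1..n}" "j \<in> {1..n}" and III: "case_III (a i) (a j) x p"
    and u: "a i * u = a i * x + a j * p - a j \<or> a i * u = a i * x + a j * p"
  shows "fresh i u"
  unfolding fresh_def
proof (intro ballI notI)
  fix k assume k: "k \<in> {1..n}" and "case_III (a i) (a k) u p"
  then have u_III: "a k < a i * u + a k * p" "a i * u + a k * p < a i"
    by (auto simp: case_III_def)
  have x_III: "a j < a i * x + a j * p" "a i * x + a j * p < a i"
    using III by (auto simp: case_III_def)
  have "0 < a k" using a_pos k by auto
  then have \<alpha>_le: "\<alpha> * a k \<le> a k * p" "\<alpha> * a k \<le> a k - a k * p"
    using mult_right_mono[OF \<alpha>_bounds(3), of "a k"] mult_right_mono[OF \<alpha>_bounds(4), of "a k"]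
    by (simp_all add: algebra_simps)
  \<comment> \<open>The ratio bound is used for the smaller of \<open>a j\<close> and
    \<open>a k\<close>.\<close>
  have "a i \<le> a j + \<alpha> * a k"
  proof (cases "a j \<le> a k")
    case True
    then have "\<alpha> * a j \<le> \<alpha> * a k" using \<alpha>_bounds by simp
    then show ?thesis using a_ratio[OF ij] by (simp add: algebra_simps)
  next
    case False
    then show ?thesis using a_ratio[OF ij(1) k] by (simp add: algebra_simps)
  qed
  with u u_III x_III \<alpha>_le show False by linarith
qed

text \<open>An entry that has become integral has its final factor and causes no further
  error.\<close>

definition loss :: "nat \<Rightarrow> real \<Rightarrow> nat list \<Rightarrow> real" where
  "loss k z L = (if 0 < z \<and> z < 1 then carried k z L else 0)"

lemma loss_outside [simp]: "k \<notin> Iplus \<union> Iminus \<Longrightarrow> loss k z L = 0"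
  by (simp add: loss_def carried_def)

text \<open>One of the two entries is integral, so at most one loss is nonzero.\<close>

lemma loss_add_le:
  assumes "u \<in> {0, 1} \<or> v \<in> {0, 1}"
  shows "loss i u L + loss j v L \<le> carry \<alpha> 0 (chosen L)"
  using assms carried_bounds[of i u L] carried_bounds[of j v L] carry_\<alpha>_nonneg[of 0 "chosen L"]
  by (auto simp: loss_def)

text \<open>Passing an unmarked \<open>j\<close> raises the count by one. In Case III the entry was
  not fresh and becomes fresh, so the count goes from 0 to 1 at no cost. Otherwise it survives with
  probability at most \<open>max p (1 - p) = 1 - \<alpha>\<close>, which pays for a count of 2 even
  if the entry loses its freshness.\<close>

lemma expected_loss_le:
  assumes ij: "i \<in> {1..n}" "j \<in> {1..n}" and q: "0 \<le> q" "q \<le> 1" and j: "j \<notin> Iplus \<union> Iminus"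
    and III: "case_III (a i) (a j) x p \<Longrightarrow>
      a i * u1 = a i * x + a j * p - a j \<and> a i * u2 = a i * x + a j * p"
    and survive: "\<not> case_III (a i) (a j) x p \<Longrightarrow>
      q * of_bool (0 < u1 \<and> u1 < 1) + (1 - q) * of_bool (0 < u2 \<and> u2 < 1) \<le> max p (1 - p)"
  shows "q * loss i u1 L + (1 - q) * loss i u2 L \<le> carried i x (j # L)"
proof (cases "i \<in> Iplus \<union> Iminus")
  case i: True
  let ?c = "\<lambda>m. carry \<alpha> m (chosen L)"
  show ?thesis
  proof (cases "case_III (a i) (a j) x p")
    case True
    then have fresh: "fresh i u1" "fresh i u2"
      using fresh_after_case_III[OF ij True] III by auto
    have "\<not> fresh i x" using True ij by (auto simp: fresh_def)
    then have "carried i x (j # L) = ?c 1" using i j by (simp add: carried_def)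
    moreover have "loss i u1 L \<le> ?c 1" "loss i u2 L \<le> ?c 1"
      using fresh carry_\<alpha>_nonneg by (auto simp: loss_def carried_def)
    ultimately show ?thesis
      using q convex_bound_le[of "loss i u1 L" "?c 1" "loss i u2 L" q "1 - q"] by simp
  next
    case False
    let ?b = "\<lambda>u. of_bool (0 < u \<and> u < (1::real)) :: real"
    have loss: "loss i u L \<le> ?b u * ?c 0" for u
      using carried_bounds[of i u L] by (simp add: loss_def)
    have "q * loss i u1 L + (1 - q) * loss i u2 L \<le> q * (?b u1 * ?c 0) + (1 - q) * (?b u2 * ?c 0)"
      using q loss by (intro add_mono mult_left_mono) auto
    also have "\<dots> = (q * ?b u1 + (1 - q) * ?b u2) * ?c 0"
      by (simp add: algebra_simps)
    also have "\<dots> \<le> (1 - \<alpha>) * ?c 0"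
      using survive[OF False] \<alpha> carry_\<alpha>_nonneg by (intro mult_right_mono) auto
    also have "\<dots> = ?c 2"
      using carry_add_2[of \<alpha> 0] by (simp add: numeral_2_eq_2)
    also have "\<dots> \<le> carried i x (j # L)"
      using i j carry_Suc_le[of \<alpha> "Suc 0" "chosen L"] \<alpha>_bounds
      by (auto simp: carried_def of_bool_def numeral_2_eq_2)
    finally show ?thesis .
  qed
qed (simp add: carried_bounds)

section \<open>Expectation for a fixed permutation\<close>

text \<open>If \<open>j\<close> is unmarked, the mean of the factor of \<open>i\<close> is preserved
  and the expected loss is at most \<open>carried\<close>. If only \<open>j\<close> is marked, its
  mean is preserved and the new loss is paid by its gap term \<open>c\<close>. If both are marked,
  \<open>carried\<close> equals 1 and crude bounds give the upper half; the lower half is not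
  claimed there.\<close>

lemma step_bounds:
  assumes ij: "i \<in> {1..n}" "j \<in> {1..n}" and q: "0 \<le> q" "q \<le> 1"
    and u: "0 \<le> u1" "u1 \<le> 1" "0 \<le> u2" "u2 \<le> 1" and v: "0 \<le> v1" "v1 \<le> 1" "0 \<le> v2" "v2 \<le> 1"
    and integral: "u1 \<in> {0, 1} \<or> v1 \<in> {0, 1}" "u2 \<in> {0, 1} \<or> v2 \<in> {0, 1}"
    and mean: "q * u1 + (1 - q) * u2 = x" "q * v1 + (1 - q) * v2 = p"
    and III: "case_III (a i) (a j) x p \<Longrightarrow>
      a i * u1 = a i * x + a j * p - a j \<and> a i * u2 = a i * x + a j * p"
    and survive: "\<not> case_III (a i) (a j) x p \<Longrightarrow>
      q * of_bool (0 < u1 \<and> u1 < 1) + (1 - q) * of_bool (0 < u2 \<and> u2 < 1) \<le> max p (1 - p)"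
    and A: "A = q * (signed i u1 * signed j v1) + (1 - q) * (signed i u2 * signed j v2)"
    and K: "K = q * (loss i u1 L + loss j v1 L) + (1 - q) * (loss i u2 L + loss j v2 L)"
    and j_factor: "c = (if j \<in> Iplus \<union> Iminus then carry \<alpha> 0 (chosen L) / \<alpha> else 0)"
  shows "A + K \<le> (signed i x + carried i x (j # L)) * (signed j p * (1 + c))"
    and "i \<notin> Iplus \<union> Iminus \<or> j \<notin> Iplus \<union> Iminus \<Longrightarrow>
      (signed i x * (1 - (c + s)) - carried i x (j # L)) * signed j p \<le> A * (1 - s) - K"
proof -
  let ?I = "Iplus \<union> Iminus" and ?C = "carry \<alpha> 0 (chosen L)"
  have x: "0 \<le> x" "x \<le> 1"
    using q u mean(1) convex_bound_le[of u1 1 u2 q "1 - q"] by auto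
  have mi: "q * signed i u1 + (1 - q) * signed i u2 = signed i x"
    and mj: "q * signed j v1 + (1 - q) * signed j v2 = signed j p"
    using mean by (auto intro: signed_convex)
  have K_le: "K \<le> ?C"
    unfolding K using q loss_add_le[OF integral(1), of i L j] loss_add_le[OF integral(2), of i L j]
    by (intro convex_bound_le) auto
  have A_le: "A \<le> signed j p"
  proof -
    have "signed i u1 * signed j v1 \<le> signed j v1" "signed i u2 * signed j v2 \<le> signed j v2"
      using signed_bounds u v by (simp_all add: mult_left_le_one_le)
    then show ?thesis
      unfolding A mj[symmetric] using q by (intro add_mono mult_left_mono) auto
  qed
  have C_le: "?C \<le> signed j p * (?C / \<alpha>)"
    using mult_right_mono[OF signed_p_ge, of "?C / \<alpha>" j] \<alpha>_bounds carry_\<alpha>_nonneg by simp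
  have "A + K \<le> (signed i x + carried i x (j # L)) * (signed j p * (1 + c)) \<and>
    (i \<notin> ?I \<or> j \<notin> ?I \<longrightarrow>
      (signed i x * (1 - (c + s)) - carried i x (j # L)) * signed j p \<le> A * (1 - s) - K)"
  proof (cases "j \<in> ?I")
    case False
    then have "A = signed i x" using mi by (simp add: A)
    moreover have "K \<le> carried i x (j # L)"
      using expected_loss_le[OF ij q False III survive, of L] False by (simp add: K)
    ultimately show ?thesis using False by (simp add: j_factor)
  next
    case j: True
    show ?thesis
    proof (cases "i \<in> ?I")
      case False
      then have "A = signed j p" using mj by (simp add: A)
      then show ?thesis
        using False j K_le C_le by (simp add: j_factor carried_def algebra_simps)
    next
      case True
      then have "carried i x (j # L) = 1" using j by (simp add: carried_def of_bool_def)
      \<comment> \<open>Here the factor of \<open>i\<close> is simply bounded by 1 inside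
        \<open>A\<close>, while \<open>K\<close> is paid by \<open>c\<close>.\<close>
      moreover have "A + K \<le> 1 * (signed j p * (1 + c))"
        using A_le K_le C_le j by (simp add: j_factor algebra_simps)
      moreover have "\<dots> \<le> (signed i x + 1) * (signed j p * (1 + c))"
        using signed_bounds x p carry_\<alpha>_nonneg \<alpha>_bounds
        by (intro mult_right_mono) (auto simp: j_factor)
      ultimately show ?thesis using True j by simp
    qed
  qed
  then show "A + K \<le> (signed i x + carried i x (j # L)) * (signed j p * (1 + c))"
    and "i \<notin> ?I \<or> j \<notin> ?I \<Longrightarrow>
      (signed i x * (1 - (c + s)) - carried i x (j # L)) * signed j p \<le> A * (1 - s) - K"
    by blast+
qed

definition finished :: "(nat \<Rightarrow> real) \<Rightarrow> nat list \<Rightarrow> real" where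
  "finished X xs = (\<Prod>k\<in>{1..n} - set xs. signed k (X k))"

lemma finished_Cons:
  assumes "k \<in> {1..n}" "k \<notin> set xs"
  shows "finished X xs = signed k (X k) * finished X (k # xs)"
proof -
  have "{1..n} - set xs = insert k ({1..n} - set (k # xs))"
    using assms by auto
  then have "finished X xs = (\<Prod>l\<in>insert k ({1..n} - set (k # xs)). signed l (X l))"
    by (simp only: finished_def)
  also have "\<dots> = signed k (X k) * finished X (k # xs)"
    unfolding finished_def by (rule prod.insert) auto
  finally show ?thesis .
qed

lemma finished_cong:
  assumes "\<And>k. k \<in> {1..n} \<Longrightarrow> k \<notin> set xs \<Longrightarrow> X k = Y k"
  shows "finished X xs = finished Y xs"
  unfolding finished_def using assms by (intro prod.cong) auto

lemma finished_nonneg: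
  assumes "\<And>k. 0 \<le> X k \<and> X k \<le> 1"
  shows "0 \<le> finished X xs"
  unfolding finished_def using signed_bounds(1) assms by (intro prod_nonneg) blast

text \<open>The entry that stays fractional becomes the new head.\<close>

definition survivors :: "nat \<Rightarrow> nat \<Rightarrow> real \<Rightarrow> real \<Rightarrow> nat list \<Rightarrow> nat list" where
  "survivors i j u v L =
    (if 0 < u \<and> u < 1 then i # L else if 0 < v \<and> v < 1 then j # L else L)"

lemma after_step_bounds:
  assumes ij: "i \<in> {1..n}" "j \<in> {1..n}" "i \<noteq> j" "i \<notin> set L" "j \<notin> set L"
    and uv: "0 \<le> u" "u \<le> 1" "0 \<le> v" "v \<le> 1"
    and integral: "u \<in> {0, 1} \<or> v \<in> {0, 1}"
    and L: "\<forall>k\<in>set L. X k = p" and X: "\<And>k. 0 \<le> X k \<and> X k \<le> 1"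
    and X': "X' = X(i := u, j := v)" and xs: "xs = survivors i j u v L"
    and r: "r = finished X (i # j # L)"
  shows "finished X' xs * upper X' xs
      \<le> r * (indep_prod L * gap_prod \<alpha> (chosen L)) * (signed i u * signed j v + (loss i u L + loss j v L))"
    and "r * indep_prod L * (signed i u * signed j v * (1 - gap_sum \<alpha> (chosen L)) - (loss i u L + loss j v L))
      \<le> finished X' xs * lower X' xs"
proof -
  let ?M = "indep_prod L * gap_prod \<alpha> (chosen L)" and ?s = "gap_sum \<alpha> (chosen L)"
  have X'_at: "X' i = u" "X' j = v" using ij by (simp_all add: X')
  have r': "finished X' (i # j # L) = r"
    unfolding r X' by (intro finished_cong) auto
  have fi: "finished X' (i # L) = signed j v * r"
    using finished_Cons[of j "i # L" X'] ij r' by (simp add: X' finished_def insert_commute)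
  have fj: "finished X' (j # L) = signed i u * r"
    using finished_Cons[of i "j # L" X'] ij r' by (simp add: X')
  have f: "finished X' L = signed i u * signed j v * r"
    using finished_Cons[of j L X'] ij fj by (simp add: X')
  have r0: "0 \<le> r" unfolding r by (rule finished_nonneg[OF X])
  have M0: "0 \<le> ?M"
    using indep_prod_nonneg gap_prod_ge_1[of \<alpha> "chosen L"] \<alpha>_bounds by simp
  have L': "\<forall>k\<in>set L. X' k = p" using L ij by (auto simp: X')
  have s01: "0 \<le> signed i u" "signed i u \<le> 1" "0 \<le> signed j v" "signed j v \<le> 1"
    using signed_bounds uv by auto
  have ci: "signed j v * carried i u L \<le> carried i u L" and cj: "signed i u * carried j v L \<le> carried j v L"
    using s01 carried_bounds by (auto intro: mult_left_le_one_le)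
  consider (i) "0 < u" "u < 1" "\<not> (0 < v \<and> v < 1)" | (j) "\<not> (0 < u \<and> u < 1)" "0 < v" "v < 1"
    | (none) "\<not> (0 < u \<and> u < 1)" "\<not> (0 < v \<and> v < 1)"
    using integral by auto
  then have "finished X' xs * upper X' xs
      \<le> r * ?M * (signed i u * signed j v + (loss i u L + loss j v L)) \<and>
    r * indep_prod L * (signed i u * signed j v * (1 - ?s) - (loss i u L + loss j v L))
      \<le> finished X' xs * lower X' xs"
  proof cases
    case i
    then have xs_eq: "xs = i # L" by (simp add: xs survivors_def)
    have "finished X' xs * upper X' xs = r * ?M * (signed j v * signed i u + signed j v * carried i u L)"
      by (simp add: xs_eq fi X'_at algebra_simps)
    moreover have "finished X' xs * lower X' xs
        = r * indep_prod L * (signed j v * signed i u * (1 - ?s) - signed j v * carried i u L)"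
      by (simp add: xs_eq fi X'_at algebra_simps)
    ultimately show ?thesis
      using i ci r0 M0 indep_prod_nonneg
      by (auto simp: loss_def mult.commute[of "signed j v"] intro!: mult_left_mono)
  next
    case j
    then have xs_eq: "xs = j # L" by (auto simp: xs survivors_def)
    have "finished X' xs * upper X' xs = r * ?M * (signed i u * signed j v + signed i u * carried j v L)"
      by (simp add: xs_eq fj X'_at algebra_simps)
    moreover have "finished X' xs * lower X' xs
        = r * indep_prod L * (signed i u * signed j v * (1 - ?s) - signed i u * carried j v L)"
      by (simp add: xs_eq fj X'_at algebra_simps)
    ultimately show ?thesis
      using j cj r0 M0 indep_prod_nonneg
      by (auto simp: loss_def intro!: mult_left_mono)
  next
    case none
    have f0: "0 \<le> finished X' L" using f s01 r0 by simp
    have xsL: "xs = L" using none by (simp add: xs survivors_def)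
    have ls: "loss i u L = 0" "loss j v L = 0" using none by (auto simp: loss_def)
    show ?thesis
      unfolding xsL ls using mult_left_mono[OF upper_le[OF L'] f0] mult_left_mono[OF lower_ge[OF L'] f0]
      by (simp add: f mult_ac)
  qed
  then show "finished X' xs * upper X' xs
      \<le> r * ?M * (signed i u * signed j v + (loss i u L + loss j v L))"
    and "r * indep_prod L * (signed i u * signed j v * (1 - ?s) - (loss i u L + loss j v L))
      \<le> finished X' xs * lower X' xs"
    by blast+
qed

text \<open>Induction on the number of fractional entries, with the invariant that only the head may
  differ from \<open>p\<close>. Nonnegativity is carried along for the steps in which two marked
  entries meet.\<close>

lemma expectation_depround_loop_bounds:
  assumes "sorted_wrt (\<lambda>k l. \<pi> k < \<pi> l) xs" "set xs = fractional n X"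
    and "\<forall>k\<in>set (tl xs). X k = p" and "\<And>k. 0 \<le> X k \<and> X k \<le> 1"
  defines "E \<equiv> \<lambda>X. measure_pmf.expectation (depround_loop n a \<pi> X) signed_prod"
  shows "0 \<le> E X \<and> finished X xs * lower X xs \<le> E X \<and> E X \<le> finished X xs * upper X xs"
  using assms(1-4)
proof (induction "length xs" arbitrary: xs X rule: less_induct)
  case less
  note sorted = less.prems(1) and set_xs = less.prems(2) and tl = less.prems(3) and X = less.prems(4)
  have dist: "distinct xs"
    using sorted by (induction xs) auto
  then have card: "card (fractional n X) = length xs"
    using set_xs distinct_card by metis
  have fin0: "finished X [] = signed_prod X"
    by (simp add: finished_def signed_prod_def)
  have nn: "0 \<le> signed_prod X"
    unfolding fin0[symmetric] using X by (rule finished_nonneg)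
  show ?case
  proof (cases "length xs < 2")
    case True
    then have E: "E X = signed_prod X"
      using card unfolding E_def by (subst depround_loop.simps) simp
    show ?thesis
    proof (cases xs)
      case Nil
      then show ?thesis using nn by (simp add: E fin0)
    next
      case (Cons i L)
      then have "xs = [i]" using True by simp
      moreover from this have "i \<in> {1..n}" using set_xs by (auto simp: fractional_def)
      ultimately show ?thesis
        using nn finished_Cons[of i "[]" X] by (simp add: E fin0 carried_def mult.commute)
    qed
  next
    case False
    then obtain i j L where xs: "xs = i # j # L"
      by (metis One_nat_def Suc_1 length_Cons less_2_cases_iff list.exhaust list.size(3) not_less_eq)
    let ?F = "\<lambda>z. case z of (u, v) \<Rightarrow> depround_loop n a \<pi> (X(i := u, j := v))"
    have ij: "i \<in> {1..n}" "j \<in> {1..n}" and x: "0 < X i" "X i < 1"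
      using set_xs by (auto simp: xs fractional_def)
    have neq: "i \<noteq> j" "i \<notin> set L" "j \<notin> set L" using dist by (auto simp: xs)
    have Xj: "X j = p" and L: "\<forall>k\<in>set L. X k = p" using tl by (auto simp: xs)
    obtain q u1 v1 u2 v2 where
      S: "simplify (a i) (a j) (X i) p = map_pmf (\<lambda>c. if c then (u1, v1) else (u2, v2)) (bernoulli_pmf q)"
      and q: "0 \<le> q" "q \<le> 1"
      and u: "0 \<le> u1" "u1 \<le> 1" "0 \<le> u2" "u2 \<le> 1" and v: "0 \<le> v1" "v1 \<le> 1" "0 \<le> v2" "v2 \<le> 1"
      and integral: "u1 \<in> {0, 1} \<or> v1 \<in> {0, 1}" "u2 \<in> {0, 1} \<or> v2 \<in> {0, 1}"
      and mean: "q * u1 + (1 - q) * u2 = X i" "q * v1 + (1 - q) * v2 = p"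
      and III: "case_III (a i) (a j) (X i) p \<Longrightarrow>
        a i * u1 = a i * X i + a j * p - a j \<and> a i * u2 = a i * X i + a j * p"
      and survive: "\<not> case_III (a i) (a j) (X i) p \<Longrightarrow>
        q * of_bool (0 < u1 \<and> u1 < 1) + (1 - q) * of_bool (0 < u2 \<and> u2 < 1) \<le> max p (1 - p)"
      using simplify_two_point[OF a_pos[OF ij(1)] a_pos[OF ij(2)] x p] by metis
    define E1 where "E1 = E (X(i := u1, j := v1))"
    define E2 where "E2 = E (X(i := u2, j := v2))"
    have "E X = measure_pmf.expectation (bind_pmf (simplify (a i) (a j) (X i) (X j)) ?F) signed_prod"
      unfolding E_def using card first_two_fractional_sorted[of \<pi> i j L n X] sorted set_xs
      by (subst depround_loop.simps) (simp add: xs)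
    also have "\<dots> = q * E1 + (1 - q) * E2"
      unfolding Xj S E1_def E2_def E_def using q
      by (subst expectation_bind_map_bernoulli) (auto split: prod.splits)
    finally have EX: "E X = q * E1 + (1 - q) * E2" .
    define r where "r = finished X (i # j # L)"
    let ?M = "indep_prod L * gap_prod \<alpha> (chosen L)" and ?s = "gap_sum \<alpha> (chosen L)"
    have r0: "0 \<le> r" unfolding r_def by (rule finished_nonneg[OF X])
    have M0: "0 \<le> ?M"
      using indep_prod_nonneg gap_prod_ge_1[of \<alpha> "chosen L"] \<alpha>_bounds by simp
    have step: "0 \<le> E (X(i := u, j := v)) \<and>
        E (X(i := u, j := v)) \<le> r * ?M * (signed i u * signed j v + (loss i u L + loss j v L)) \<and>
        r * indep_prod L * (signed i u * signed j v * (1 - ?s) - (loss i u L + loss j v L))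
          \<le> E (X(i := u, j := v))"
      if uv: "0 \<le> u" "u \<le> 1" "0 \<le> v" "v \<le> 1" and int: "u \<in> {0, 1} \<or> v \<in> {0, 1}" for u v
    proof -
      let ?X' = "X(i := u, j := v)" and ?xs' = "survivors i j u v L"
      have "sorted_wrt (\<lambda>k l. \<pi> k < \<pi> l) ?xs'"
        using sorted by (auto simp: survivors_def xs)
      moreover have "fractional n ?X' = fractional n X - {i, j} \<union>
          (if 0 < u \<and> u < 1 then {i} else {}) \<union> (if 0 < v \<and> v < 1 then {j} else {})"
        using ij neq by (auto simp: fractional_def)
      then have "set ?xs' = fractional n ?X'"
        using neq int unfolding set_xs[symmetric] by (auto simp: survivors_def xs)
      moreover
      have tl_subset: "set (tl L) \<subseteq> set L"
        by (cases L) auto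
      then have "\<forall>k\<in>set (tl ?xs'). ?X' k = p"
        using L neq tl_subset by (auto simp: survivors_def)
      moreover have "0 \<le> ?X' k \<and> ?X' k \<le> 1" for k
        using X uv by simp
      moreover have "length ?xs' < length xs"
        by (simp add: survivors_def xs)
      ultimately have "0 \<le> E ?X' \<and> finished ?X' ?xs' * lower ?X' ?xs' \<le> E ?X'
          \<and> E ?X' \<le> finished ?X' ?xs' * upper ?X' ?xs'"
        using less.hyps by blast
      with after_step_bounds[OF ij neq uv int L X refl refl r_def] show ?thesis
        by linarith
    qed
    note step1 = step[OF u(1,2) v(1,2) integral(1), folded E1_def]
    note step2 = step[OF u(3,4) v(3,4) integral(2), folded E2_def]
    define A where "A = q * (signed i u1 * signed j v1) + (1 - q) * (signed i u2 * signed j v2)"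
    define K where "K = q * (loss i u1 L + loss j v1 L) + (1 - q) * (loss i u2 L + loss j v2 L)"
    define c where "c = (if j \<in> Iplus \<union> Iminus then carry \<alpha> 0 (chosen L) / \<alpha> else 0)"
    note core = step_bounds[OF ij q u v integral mean III survive A_def K_def c_def]
    have E0: "0 \<le> E X"
      unfolding EX using step1 step2 q by simp
    have "E X \<le> q * (r * ?M * (signed i u1 * signed j v1 + (loss i u1 L + loss j v1 L)))
        + (1 - q) * (r * ?M * (signed i u2 * signed j v2 + (loss i u2 L + loss j v2 L)))"
      unfolding EX using step1 step2 q by (intro add_mono mult_left_mono) auto
    also have "\<dots> = r * ?M * (A + K)"
      by (simp add: A_def K_def algebra_simps)
    also have "\<dots> \<le> r * ?M * ((signed i (X i) + carried i (X i) (j # L)) * (signed j p * (1 + c)))"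
      using r0 M0 by (intro mult_left_mono core(1)) auto
    also have "\<dots> = r * upper X xs"
      by (simp add: xs c_def mult_ac)
    finally have up: "E X \<le> finished X xs * upper X xs"
      by (simp add: r_def xs)
    have low: "r * lower X xs \<le> E X"
    proof (cases "i \<in> Iplus \<union> Iminus \<and> j \<in> Iplus \<union> Iminus")
      case True
      \<comment> \<open>The loss 1 exceeds or equals the factor of \<open>i\<close>, so
        \<open>0 \<le> E X\<close> suffices when both entries are marked.\<close>
      have "lower X xs \<le> 0"
      proof -
        have "carried i (X i) (j # L) = 1"
          using True by (simp add: carried_def of_bool_def)
        moreover have "0 \<le> gap_sum \<alpha> (chosen (j # L))"
          using \<alpha>_bounds by (intro gap_sum_nonneg) auto
        then have "signed i (X i) * (1 - gap_sum \<alpha> (chosen (j # L))) \<le> signed i (X i) * 1"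
          using signed_bounds x by (intro mult_left_mono) auto
        moreover have "signed i (X i) \<le> 1"
          using signed_bounds x by simp
        ultimately show ?thesis
          using indep_prod_nonneg[of "j # L"]
          unfolding xs lower.simps by (intro mult_nonpos_nonneg) linarith+
      qed
      then show ?thesis
        using r0 E0 mult_nonneg_nonpos by fastforce
    next
      case False
      have "r * lower X xs = r * indep_prod L * ((signed i (X i) * (1 - (c + ?s)) - carried i (X i) (j # L)) * signed j p)"
        by (simp add: xs c_def mult_ac)
      also have "\<dots> \<le> r * indep_prod L * (A * (1 - ?s) - K)"
        using r0 indep_prod_nonneg False by (intro mult_left_mono core(2)) auto
      also have "\<dots> = q * (r * indep_prod L * (signed i u1 * signed j v1 * (1 - ?s) - (loss i u1 L + loss j v1 L)))
          + (1 - q) * (r * indep_prod L * (signed i u2 * signed j v2 * (1 - ?s) - (loss i u2 L + loss j v2 L)))"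
        by (simp add: A_def K_def algebra_simps)
      also have "\<dots> \<le> E X"
        unfolding EX using step1 step2 q by (intro add_mono mult_left_mono) auto
      finally show ?thesis .
    qed
    show ?thesis using E0 up low by (simp add: r_def xs)
  qed
qed

lemma signed_prod_eq:
  assumes "Iplus \<subseteq> {1..n}" "Iminus \<subseteq> {1..n}"
  shows "signed_prod X = (\<Prod>k\<in>Iplus. X k) * (\<Prod>k\<in>Iminus. 1 - X k)"
proof -
  have fin: "finite Iplus" "finite Iminus"
    using assms finite_subset by blast+
  have "signed_prod X = (\<Prod>k\<in>Iplus \<union> Iminus. signed k (X k))"
    unfolding signed_prod_def using assms by (intro prod.mono_neutral_right) auto
  also have "\<dots> = (\<Prod>k\<in>Iplus. signed k (X k)) * (\<Prod>k\<in>Iminus. signed k (X k))"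
    using fin disjoint by (rule prod.union_disjoint)
  also have "(\<Prod>k\<in>Iplus. signed k (X k)) = (\<Prod>k\<in>Iplus. X k)"
    by (simp add: signed_def)
  also have "(\<Prod>k\<in>Iminus. signed k (X k)) = (\<Prod>k\<in>Iminus. 1 - X k)"
    using disjoint by (intro prod.cong) (auto simp: signed_def)
  finally show ?thesis .
qed

text \<open>As \<pi> maps indices to positions, \<open>inv \<pi>\<close> lists the indices in
  \<pi>-order. At the start all entries are fractional and equal to \<open>p\<close>, so
  \<open>finished\<close> is 1 and the loss of the head is absorbed too.\<close>

lemma expectation_given_permutation_bounds:
  assumes \<pi>: "\<pi> permutes {1..n}"
  defines "bs \<equiv> map (\<lambda>m. inv \<pi> m \<in> Iplus \<union> Iminus) [1..<Suc n]"
    and "E \<equiv> measure_pmf.expectation (depround_loop n a \<pi> (\<lambda>_. p)) signed_prod"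
  shows "signed_prod (\<lambda>_. p) * (1 - gap_sum \<alpha> bs) \<le> E" "E \<le> signed_prod (\<lambda>_. p) * gap_prod \<alpha> bs"
proof -
  let ?xs = "map (inv \<pi>) [1..<Suc n]"
  have inv: "inv \<pi> permutes {1..n}" using \<pi> by (rule permutes_inv)
  have set_xs: "set ?xs = {1..n}"
    using permutes_image[OF inv] by (simp add: atLeastLessThanSuc_atLeastAtMost del: upt_Suc)
  have frac: "set ?xs = fractional n (\<lambda>_. p)"
    unfolding set_xs using p by (auto simp: fractional_def)
  have sorted: "sorted_wrt (\<lambda>k l. \<pi> k < \<pi> l) ?xs"
    using permutes_inverses(1)[OF \<pi>] by (simp add: sorted_wrt_map del: upt_Suc)
  have bs: "chosen ?xs = bs"
    by (simp add: chosen_def bs_def comp_def del: upt_Suc)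
  have dist: "distinct ?xs"
    using permutes_inj_on[OF inv] by (simp add: distinct_map del: upt_Suc)
  have \<Lambda>: "indep_prod ?xs = signed_prod (\<lambda>_. p)"
    unfolding indep_prod_def signed_prod_def set_xs[symmetric] using dist by (rule prod.distinct_set_conv_list[symmetric])
  have "finished (\<lambda>_. p) ?xs = 1"
    unfolding finished_def set_xs by simp
  then have "lower (\<lambda>_. p) ?xs \<le> E" "E \<le> upper (\<lambda>_. p) ?xs"
    using expectation_depround_loop_bounds[OF sorted frac] p by (simp_all add: E_def del: upt_Suc)
  then show "signed_prod (\<lambda>_. p) * (1 - gap_sum \<alpha> bs) \<le> E" "E \<le> signed_prod (\<lambda>_. p) * gap_prod \<alpha> bs"
    using lower_ge[of ?xs "\<lambda>_. p"] upper_le[of ?xs "\<lambda>_. p"] unfolding \<Lambda> bs by auto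
qed

section \<open>Averaging over the permutation\<close>

lemma expectation_depround_bounds:
  assumes I: "Iplus \<union> Iminus \<subseteq> {1..n}" and t: "card (Iplus \<union> Iminus) = Suc t"
  defines "E \<equiv> measure_pmf.expectation (depround n (\<lambda>_. p) a) signed_prod"
  shows "(1 - 2 / \<alpha>\<^sup>2 * real t * real (Suc t) / real n) * signed_prod (\<lambda>_. p) \<le> E"
    and "E \<le> (1 + 2 / \<alpha>\<^sup>2 * real (Suc t) / real n) ^ t * signed_prod (\<lambda>_. p)"
proof -
  let ?P = "{\<pi>. \<pi> permutes {1..n}}" and ?\<Lambda> = "signed_prod (\<lambda>_. p)"
  let ?bs = "\<lambda>\<pi>. map (\<lambda>m. inv \<pi> m \<in> Iplus \<union> Iminus) [1..<Suc n]"
  let ?E = "\<lambda>\<pi>. measure_pmf.expectation (depround_loop n a \<pi> (\<lambda>_. p)) signed_prod"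
  have card: "real (card ?P) = fact n" by (simp add: card_permutations)
  have \<Lambda>: "0 \<le> ?\<Lambda>"
    unfolding signed_prod_def using signed_bounds(1) p by (intro prod_nonneg) auto
  have "id \<in> ?P" by (simp add: permutes_id)
  then have "?P \<noteq> {}" by blast
  then have "E = (\<Sum>\<pi>\<in>?P. ?E \<pi> /\<^sub>R real (card ?P))"
    unfolding E_def depround_def
    by (intro pmf_expectation_bind_pmf_of_set) (auto simp: finite_permutations)
  then have E: "E = (\<Sum>\<pi>\<in>?P. ?E \<pi>) / fact n"
    unfolding card by (simp add: divide_inverse sum_distrib_left mult.commute)
  have "E \<le> (\<Sum>\<pi>\<in>?P. ?\<Lambda> * gap_prod \<alpha> (?bs \<pi>)) / fact n"
    unfolding E using expectation_given_permutation_bounds(2) by (intro divide_right_mono sum_mono) auto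
  also have "\<dots> = ?\<Lambda> * ((\<Sum>\<pi>\<in>?P. gap_prod \<alpha> (?bs \<pi>)) / fact n)"
    by (simp add: sum_distrib_left del: upt_Suc)
  also have "\<dots> \<le> ?\<Lambda> * (1 + 2 / \<alpha>\<^sup>2 * real (Suc t) / real n) ^ t"
    using average_gap_prod_le[OF \<alpha>_bounds(1,2) I t] \<Lambda> by (rule mult_left_mono)
  finally show "E \<le> (1 + 2 / \<alpha>\<^sup>2 * real (Suc t) / real n) ^ t * ?\<Lambda>"
    by (simp add: mult.commute)
  have "?\<Lambda> * (1 - 2 / \<alpha>\<^sup>2 * real t * real (Suc t) / real n)
      \<le> ?\<Lambda> * (1 - (\<Sum>\<pi>\<in>?P. gap_sum \<alpha> (?bs \<pi>)) / fact n)"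
    using average_gap_sum_le[OF \<alpha>_bounds(1,2) I t] \<Lambda> by (intro mult_left_mono) auto
  also have "\<dots> = (\<Sum>\<pi>\<in>?P. ?\<Lambda> * (1 - gap_sum \<alpha> (?bs \<pi>))) / fact n"
    using card
    by (simp add: sum_subtractf right_diff_distrib diff_divide_distrib sum_distrib_left[symmetric] del: upt_Suc)
  also have "\<dots> \<le> E"
    unfolding E using expectation_given_permutation_bounds(1) by (intro divide_right_mono sum_mono) auto
  finally show "(1 - 2 / \<alpha>\<^sup>2 * real t * real (Suc t) / real n) * ?\<Lambda> \<le> E"
    by (simp add: mult.commute)
qed

end

theorem theorem2p11:
  fixes n t :: nat and p \<alpha> \<Lambda> :: real and a :: "nat \<Rightarrow> real" and Iplus Iminus :: "nat set"
  assumes "1 \<le> n"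
    and "0 < p" and "p < 1"
    and "\<And>i. i \<in> {1..n} \<Longrightarrow> 0 < a i"
    and "\<alpha> = min p (1 - p)"
    and "Iplus \<subseteq> {1..n}" and "Iminus \<subseteq> {1..n}" and "Iplus \<inter> Iminus = {}"
    and "t = card (Iplus \<union> Iminus)"
    and "\<Lambda> = p ^ card Iplus * (1 - p) ^ card Iminus"
    and "Max (a ` {1..n}) / Min (a ` {1..n}) \<le> 1 + \<alpha>"
  shows "(1 - 8 * real t * (real t - 1) / (3 * real n * \<alpha>\<^sup>2)) * \<Lambda>
           \<le> measure_pmf.expectation (depround n (\<lambda>_. p) a)
                (\<lambda>X. (\<Prod>i\<in>Iplus. X i) * (\<Prod>i\<in>Iminus. 1 - X i))
       \<and> measure_pmf.expectation (depround n (\<lambda>_. p) a)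
                (\<lambda>X. (\<Prod>i\<in>Iplus. X i) * (\<Prod>i\<in>Iminus. 1 - X i))
           \<le> (1 + 8 * real t / (3 * real n * \<alpha>\<^sup>2)) powi (int t - 1) * \<Lambda>"
proof -
  have fin: "finite Iplus" "finite Iminus"
    using assms(6,7) finite_subset by blast+
  have ratio: "a i \<le> (1 + \<alpha>) * a j" if "i \<in> {1..n}" "j \<in> {1..n}" for i j
  proof -
    have "Min (a ` {1..n}) \<in> a ` {1..n}" using that by (intro Min_in) auto
    then have "0 < Min (a ` {1..n})" using assms(4) by fastforce
    then have "Max (a ` {1..n}) \<le> (1 + \<alpha>) * Min (a ` {1..n})"
      using assms(11) by (simp add: pos_divide_le_eq)
    moreover have "a i \<le> Max (a ` {1..n})" using that by (intro Max_ge) auto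
    moreover have "(1 + \<alpha>) * Min (a ` {1..n}) \<le> (1 + \<alpha>) * a j"
      using that assms(2,3,5) by (intro mult_left_mono Min_le) auto
    ultimately show ?thesis by linarith
  qed
  interpret depround_setting n p \<alpha> a Iplus Iminus
    using assms(2-5,8) ratio by unfold_locales auto
  have prod_eq: "signed_prod = (\<lambda>X. (\<Prod>i\<in>Iplus. X i) * (\<Prod>i\<in>Iminus. 1 - X i))"
    using signed_prod_eq[OF assms(6,7)] by blast
  have \<Lambda>: "signed_prod (\<lambda>_. p) = \<Lambda>" "0 \<le> \<Lambda>"
    using assms(2,3,10) by (simp_all add: prod_eq)
  show ?thesis
  proof (cases t)
    case 0
    \<comment> \<open>The exponent is -1 here, but the base is 1, and both products are
      empty.\<close>
    then have "Iplus = {}" "Iminus = {}" using fin assms(9) by auto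
    then show ?thesis using 0 assms(10) by simp
  next
    case (Suc t')
    have I: "Iplus \<union> Iminus \<subseteq> {1..n}" and card: "card (Iplus \<union> Iminus) = Suc t'"
      using assms(6,7,9) Suc by auto
    define \<delta> where "\<delta> = real t / (real n * \<alpha>\<^sup>2)"
    have \<delta>: "0 \<le> \<delta>" by (simp add: \<delta>_def)
    have two: "2 / \<alpha>\<^sup>2 * real (Suc t') / real n = 2 * \<delta>"
      "2 / \<alpha>\<^sup>2 * real t' * real (Suc t') / real n = 2 * (real t' * \<delta>)"
      using Suc by (simp_all add: \<delta>_def mult_ac)
    have eight: "8 * real t / (3 * real n * \<alpha>\<^sup>2) = 8 / 3 * \<delta>"
      "8 * real t * (real t - 1) / (3 * real n * \<alpha>\<^sup>2) = 8 / 3 * (real t' * \<delta>)"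
      using Suc by (simp_all add: \<delta>_def mult_ac)
    \<comment> \<open>The averaged bounds hold with the constant 2, which is weakened to
      \<open>8 / 3\<close>.\<close>
    have "(1 - 8 / 3 * (real t' * \<delta>)) * \<Lambda> \<le> (1 - 2 * (real t' * \<delta>)) * \<Lambda>"
      using \<Lambda>(2) mult_nonneg_nonneg[OF of_nat_0_le_iff \<delta>, of t'] by (intro mult_right_mono) linarith+
    moreover have "(1 + 2 * \<delta>) ^ t' * \<Lambda> \<le> (1 + 8 / 3 * \<delta>) ^ t' * \<Lambda>"
      using \<Lambda>(2) \<delta> by (intro mult_right_mono power_mono) auto
    moreover have "x powi (int t - 1) = x ^ t'" for x :: real
      using Suc by simp
    ultimately show ?thesis
      using expectation_depround_bounds[OF I card]
      unfolding eight two \<Lambda>(1) unfolding prod_eq by (auto intro: order_trans)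
  qed
qed

end
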